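(* Let $\mathcal{E},\mathcal{E}'$ be separable complex Hilbert spaces and let $T:\mathcal{E}\to\mathcal{E}'$ be a partial isometry, viewed as a constant function in $H_1^\infty(\mathcal{E},\mathcal{E}')$. Then $T$ Shmul'yan-ter Horst dominates every function $G\in H_1^\infty(\mathcal{E},\mathcal{E}')$ with $G(\mathbb{D})\subset\Delta_{\mathrm{Sh}}(T)$.
   Context: $\mathbb{D}$ is the open unit disc. $H_1^\infty(\mathcal{E},\mathcal{E}')$ is the set of analytic functions $F:\mathbb{D}\to\mathcal{B}(\mathcal{E},\mathcal{E}')$ with $\|F(z)\|\le 1$ for all $z\in\mathbb{D}$. $T$ is a partial isometry if $TT^*T=T$. For a contraction $A$ between Hilbert spaces, $D_A=(I-A^*A)^{1/2}$ and $\mathcal{D}_A=\overline{\mathcal{R}(D_A)}$. For contractions $A,B\in\mathcal{B}(\mathcal{H}_1,\mathcal{H}_2)$, $A$ Shmul'yan dominates $B$ if $B=A+D_{A^*}XD_A$ for some bounded $X\in\mathcal{B}(\mathcal{D}_A,\mathcal{D}_{A^*})$; $A,B$ are Shmul'yan equivalent if each Shmul'yan dominates the other; $\Delta_{\mathrm{Sh}}(T)$ (Shmul'yan part) is the set of contractions $\mathcal{E}\to\mathcal{E}'$ Shmul'yan equivalent to $T$. For $F\in H_1^\infty(\mathcal{E},\mathcal{E}')$, the Toeplitz operator $T_F:H^2(\mathcal{E})\to H^2(\mathcal{E}')$ between vector-valued Hardy spaces is the contraction $(T_Fg)(\lambda)=F(\lambda)g(\lambda)$. For $F,G\in H_1^\infty(\mathcal{E},\mathcal{E}')$,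 $G$ Shmul'yan-ter Horst dominates $F$ if $T_G$ Shmul'yan dominates $T_F$ as contractions $H^2(\mathcal{E})\to H^2(\mathcal{E}')$. *)

theory Defs
  imports "HOL-Complex_Analysis.Complex_Analysis"
begin

section \<open>Complex Hilbert spaces\<close>

class complex_vector = real_vector +
  fixes scaleC :: "complex \<Rightarrow> 'a \<Rightarrow> 'a" (infixr \<open>*\<^sub>C\<close> 75)
  assumes scaleC_add_right: "c *\<^sub>C (x + y) = c *\<^sub>C x + c *\<^sub>C y"
    and scaleC_add_left: "(c + d) *\<^sub>C x = c *\<^sub>C x + d *\<^sub>C x"
    and scaleC_scaleC: "c *\<^sub>C d *\<^sub>C x = (c * d) *\<^sub>C x"
    and scaleR_scaleC: "r *\<^sub>R x = complex_of_real r *\<^sub>C x"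
begin

lemma scaleC_zero_left [simp]: "0 *\<^sub>C x = 0"
  using scaleC_add_left[of 0 0 x] by simp

lemma scaleC_zero_right [simp]: "c *\<^sub>C 0 = 0"
  using scaleC_add_right[of c 0 0] by simp

lemma scaleC_minus_right [simp]: "c *\<^sub>C (- x) = - (c *\<^sub>C x)"
  using scaleC_add_right[of c x "- x"] by (simp add: eq_neg_iff_add_eq_0 add.commute)

lemma scaleC_diff_right: "c *\<^sub>C (x - y) = c *\<^sub>C x - c *\<^sub>C y"
  using scaleC_add_right[of c x "- y"] by simp

end

lemma scaleC_one [simp]: "1 *\<^sub>C (x :: 'a::complex_vector) = x"
  using scaleR_scaleC[of 1 x] by simp

lemma scaleC_minus_one: "(- 1) *\<^sub>C (x :: 'a::complex_vector) = - x"
  using scaleR_scaleC[of "- 1" x] by simp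

class complex_normed_vector = real_normed_vector + complex_vector +
  assumes norm_scaleC: "norm (c *\<^sub>C x) = cmod c * norm x"

text \<open>
  The inner product is linear in the first argument. The norm is the one of the underlying
  real inner product space, so that \<open>(norm x)\<^sup>2 = Re (cinner x x)\<close>.
\<close>

class complex_inner = real_inner + complex_vector +
  fixes cinner :: "'a \<Rightarrow> 'a \<Rightarrow> complex"
  assumes cinner_commute: "cinner x y = cnj (cinner y x)"
    and cinner_add_left: "cinner (x + y) z = cinner x z + cinner y z"
    and cinner_scaleC_left: "cinner (c *\<^sub>C x) y = c * cinner x y"
    and inner_eq_Re_cinner: "inner x y = Re (cinner x y)"
begin

lemma cinner_scaleC_right: "cinner x (c *\<^sub>C y) = cnj c * cinner x y"
  by (subst (1 2) cinner_commute) (simp add: cinner_scaleC_left)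

lemma cinner_zero_left [simp]: "cinner 0 y = 0"
  using cinner_add_left[of 0 0 y] by simp

lemma cinner_minus_left [simp]: "cinner (- x) y = - cinner x y"
  by (rule group_add_class.minus_unique[symmetric]) (simp flip: cinner_add_left)

lemma cinner_diff_left: "cinner (x - y) z = cinner x z - cinner y z"
  using cinner_add_left[of x "- y" z] by simp

lemma Im_cinner: "Im (cinner x y) = inner x (\<i> *\<^sub>C y)"
  by (simp add: inner_eq_Re_cinner cinner_scaleC_right)

subclass complex_normed_vector
proof
  fix c :: complex and x :: 'a
  have "cinner (c *\<^sub>C x) (c *\<^sub>C x) = complex_of_real ((cmod c)\<^sup>2) * cinner x x"
    by (simp add: cinner_scaleC_left cinner_scaleC_right complex_norm_square mult.assoc del: of_real_power)
  then have "inner (c *\<^sub>C x) (c *\<^sub>C x) = (cmod c)\<^sup>2 * inner x x"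
    by (simp add: inner_eq_Re_cinner del: of_real_power)
  then show "norm (c *\<^sub>C x) = cmod c * norm x"
    by (simp add: norm_eq_sqrt_inner real_sqrt_mult)
qed

lemma norm_cinner_self: "cinner x x = complex_of_real ((norm x)\<^sup>2)"
proof (rule complex_eqI)
  show "Re (cinner x x) = Re (complex_of_real ((norm x)\<^sup>2))"
    by (simp add: power2_norm_eq_inner inner_eq_Re_cinner del: of_real_power)
  show "Im (cinner x x) = Im (complex_of_real ((norm x)\<^sup>2))"
    using arg_cong[OF cinner_commute[of x x], of Im] by (simp del: of_real_power)
qed

lemma cmod_cinner_le: "cmod (cinner x y) \<le> norm x * norm y"
proof (cases "cinner x y = 0")
  case False
  define c where "c = cnj (cinner x y) / of_real (cmod (cinner x y))"
  have c: "cmod c = 1"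
    using False by (simp add: c_def norm_divide)
  have "c * cinner x y = of_real (cmod (cinner x y))"
    using False complex_norm_square[of "cinner x y"]
    by (simp add: c_def field_simps power2_eq_square)
  then have "cmod (cinner x y) = Re (cinner (c *\<^sub>C x) y)"
    by (simp add: cinner_scaleC_left)
  also have "\<dots> \<le> norm (c *\<^sub>C x) * norm y"
    using norm_cauchy_schwarz[of "c *\<^sub>C x" y] by (simp add: inner_eq_Re_cinner)
  finally show ?thesis
    by (simp add: norm_scaleC c)
qed simp

end

lemma bounded_linear_scaleC: "bounded_linear (\<lambda>x::'a::complex_normed_vector. c *\<^sub>C x)"
  by (rule bounded_linear_intro[of _ "cmod c"])
     (simp_all add: scaleC_add_right scaleR_scaleC scaleC_scaleC norm_scaleC mult.commute)

lemma bounded_linear_cinner_left: "bounded_linear (\<lambda>x::'a::complex_inner. cinner x y)"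
  by (rule bounded_linear_intro[of _ "norm y"])
     (simp_all add: cinner_add_left scaleR_scaleC cinner_scaleC_left scaleR_conv_of_real cmod_cinner_le)

class chilbert_space = complex_inner + complete_space
begin
subclass banach ..
end

instantiation complex :: chilbert_space
begin
definition scaleC_complex :: "complex \<Rightarrow> complex \<Rightarrow> complex" where "scaleC_complex c x = c * x"
definition cinner_complex :: "complex \<Rightarrow> complex \<Rightarrow> complex" where "cinner_complex x y = x * cnj y"
instance
  by standard (simp_all add: scaleC_complex_def cinner_complex_def inner_complex_def
      algebra_simps scaleR_conv_of_real)
end

section \<open>Bounded complex linear operators\<close>

definition bounded_clinear :: "('a::complex_normed_vector \<Rightarrow> 'b::complex_normed_vector) \<Rightarrow> bool" where
  "bounded_clinear A \<longleftrightarrow> bounded_linear A \<and> (\<forall>c x. A (c *\<^sub>C x) = c *\<^sub>C A x)"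

typedef (overloaded) ('a, 'b) cblinfun (\<open>(_ \<Rightarrow>\<^sub>C\<^sub>L /_)\<close> [22, 21] 21) =
  "{A :: 'a::complex_normed_vector \<Rightarrow> 'b::complex_normed_vector. bounded_clinear A}"
  morphisms cblinfun_apply CBlinfun
  by (rule exI[of _ "\<lambda>_. 0"]) (simp add: bounded_clinear_def)

notation cblinfun_apply (infixr \<open>*\<^sub>V\<close> 70)

setup_lifting type_definition_cblinfun

lemma cblinfun_eqI: "(\<And>x. A *\<^sub>V x = B *\<^sub>V x) \<Longrightarrow> A = B"
  by transfer auto

instantiation cblinfun :: (complex_normed_vector, complex_normed_vector) complex_normed_vector
begin

lift_definition norm_cblinfun :: "'a \<Rightarrow>\<^sub>C\<^sub>L 'b \<Rightarrow> real" is onorm .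

lift_definition zero_cblinfun :: "'a \<Rightarrow>\<^sub>C\<^sub>L 'b" is "\<lambda>x. 0"
  by (simp add: bounded_clinear_def)

lift_definition plus_cblinfun :: "'a \<Rightarrow>\<^sub>C\<^sub>L 'b \<Rightarrow> 'a \<Rightarrow>\<^sub>C\<^sub>L 'b \<Rightarrow> 'a \<Rightarrow>\<^sub>C\<^sub>L 'b" is "\<lambda>f g x. f x + g x"
  by (simp add: bounded_clinear_def bounded_linear_add scaleC_add_right)

lift_definition minus_cblinfun :: "'a \<Rightarrow>\<^sub>C\<^sub>L 'b \<Rightarrow> 'a \<Rightarrow>\<^sub>C\<^sub>L 'b \<Rightarrow> 'a \<Rightarrow>\<^sub>C\<^sub>L 'b" is "\<lambda>f g x. f x - g x"
  by (simp add: bounded_clinear_def bounded_linear_sub scaleC_diff_right)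

lift_definition uminus_cblinfun :: "'a \<Rightarrow>\<^sub>C\<^sub>L 'b \<Rightarrow> 'a \<Rightarrow>\<^sub>C\<^sub>L 'b" is "\<lambda>f x. - f x"
  by (simp add: bounded_clinear_def bounded_linear_minus)

lift_definition scaleR_cblinfun :: "real \<Rightarrow> 'a \<Rightarrow>\<^sub>C\<^sub>L 'b \<Rightarrow> 'a \<Rightarrow>\<^sub>C\<^sub>L 'b" is "\<lambda>r f x. r *\<^sub>R f x"
  by (auto simp: bounded_clinear_def scaleR_scaleC scaleC_scaleC mult.commute
      intro!: bounded_linear_compose[OF bounded_linear_scaleC])

lift_definition scaleC_cblinfun :: "complex \<Rightarrow> 'a \<Rightarrow>\<^sub>C\<^sub>L 'b \<Rightarrow> 'a \<Rightarrow>\<^sub>C\<^sub>L 'b" is "\<lambda>c f x. c *\<^sub>C f x"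
  by (auto simp: bounded_clinear_def scaleC_scaleC mult.commute
      intro!: bounded_linear_compose[OF bounded_linear_scaleC])

definition dist_cblinfun :: "'a \<Rightarrow>\<^sub>C\<^sub>L 'b \<Rightarrow> 'a \<Rightarrow>\<^sub>C\<^sub>L 'b \<Rightarrow> real" where
  "dist_cblinfun A B = norm (A - B)"

definition sgn_cblinfun :: "'a \<Rightarrow>\<^sub>C\<^sub>L 'b \<Rightarrow> 'a \<Rightarrow>\<^sub>C\<^sub>L 'b" where
  "sgn_cblinfun A = inverse (norm A) *\<^sub>R A"

definition uniformity_cblinfun :: "(('a \<Rightarrow>\<^sub>C\<^sub>L 'b) \<times> ('a \<Rightarrow>\<^sub>C\<^sub>L 'b)) filter" where
  "uniformity_cblinfun = (INF e\<in>{0 <..}. principal {(x, y). dist x y < e})"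

definition open_cblinfun :: "('a \<Rightarrow>\<^sub>C\<^sub>L 'b) set \<Rightarrow> bool" where
  "open_cblinfun S = (\<forall>x\<in>S. \<forall>\<^sub>F (x', y) in uniformity. x' = x \<longrightarrow> y \<in> S)"

instance
proof
  fix A B C :: "'a \<Rightarrow>\<^sub>C\<^sub>L 'b" and r s :: real and c d :: complex
  show "A + B + C = A + (B + C)" "A + B = B + A" "0 + A = A" "- A + A = 0" "A - B = A + - B"
    by (transfer, simp add: algebra_simps)+
  show "r *\<^sub>R (A + B) = r *\<^sub>R A + r *\<^sub>R B" "(r + s) *\<^sub>R A = r *\<^sub>R A + s *\<^sub>R A"
    "r *\<^sub>R s *\<^sub>R A = (r * s) *\<^sub>R A" "1 *\<^sub>R A = A"
    by (transfer, simp add: algebra_simps)+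
  show "dist A B = norm (A - B)" "sgn A = inverse (norm A) *\<^sub>R A"
    by (simp_all add: dist_cblinfun_def sgn_cblinfun_def)
  show "(uniformity :: (('a \<Rightarrow>\<^sub>C\<^sub>L 'b) \<times> ('a \<Rightarrow>\<^sub>C\<^sub>L 'b)) filter) =
      (INF e\<in>{0 <..}. principal {(x, y). dist x y < e})"
    by (rule uniformity_cblinfun_def)
  show "open U \<longleftrightarrow> (\<forall>x\<in>U. \<forall>\<^sub>F (x', y) in uniformity. x' = x \<longrightarrow> y \<in> U)" for U :: "('a \<Rightarrow>\<^sub>C\<^sub>L 'b) set"
    by (rule open_cblinfun_def)
  show "norm A = 0 \<longleftrightarrow> A = 0"
    by transfer (auto simp: bounded_clinear_def onorm_eq_0)
  show "norm (A + B) \<le> norm A + norm B"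
    by transfer (auto simp: bounded_clinear_def onorm_triangle)
  show "norm (r *\<^sub>R A) = \<bar>r\<bar> * norm A"
    by transfer (auto simp: bounded_clinear_def onorm_scaleR)
  show "c *\<^sub>C (A + B) = c *\<^sub>C A + c *\<^sub>C B" "(c + d) *\<^sub>C A = c *\<^sub>C A + d *\<^sub>C A"
    "c *\<^sub>C d *\<^sub>C A = (c * d) *\<^sub>C A" "r *\<^sub>R A = complex_of_real r *\<^sub>C A"
    by (transfer, simp add: scaleC_add_right scaleC_add_left scaleC_scaleC scaleR_scaleC)+
  show "norm (c *\<^sub>C A) = cmod c * norm A"
  proof transfer
    fix c and f :: "'a \<Rightarrow> 'b"
    assume "bounded_clinear f"
    then have f: "bounded_linear f"
      by (simp add: bounded_clinear_def)
    have "onorm (\<lambda>x. c *\<^sub>C f x) = onorm (\<lambda>x. cmod c *\<^sub>R f x)"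
      by (simp add: onorm_def norm_scaleC)
    then show "onorm (\<lambda>x. c *\<^sub>C f x) = cmod c * onorm f"
      using onorm_scaleR[OF f, of "cmod c"] by simp
  qed
qed

end

lift_definition cblinfun_compose ::
  "'b::complex_normed_vector \<Rightarrow>\<^sub>C\<^sub>L 'c::complex_normed_vector \<Rightarrow> 'a::complex_normed_vector \<Rightarrow>\<^sub>C\<^sub>L 'b \<Rightarrow> 'a \<Rightarrow>\<^sub>C\<^sub>L 'c"
  (infixl \<open>o\<^sub>C\<^sub>L\<close> 67) is "\<lambda>f g x. f (g x)"
  by (simp add: bounded_clinear_def bounded_linear_compose)

lift_definition id_cblinfun :: "'a::complex_normed_vector \<Rightarrow>\<^sub>C\<^sub>L 'a" is "\<lambda>x. x"
  by (simp add: bounded_clinear_def)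

definition adj :: "'a::chilbert_space \<Rightarrow>\<^sub>C\<^sub>L 'b::chilbert_space \<Rightarrow> 'b \<Rightarrow>\<^sub>C\<^sub>L 'a" where
  "adj A = (THE B. \<forall>x y. cinner (A *\<^sub>V x) y = cinner x (B *\<^sub>V y))"

definition positive_op :: "'a::chilbert_space \<Rightarrow>\<^sub>C\<^sub>L 'a \<Rightarrow> bool" where
  "positive_op S \<longleftrightarrow> (\<forall>x. cinner (S *\<^sub>V x) x \<in> \<real>\<^sub>\<ge>\<^sub>0)"

definition sqrt_op :: "'a::chilbert_space \<Rightarrow>\<^sub>C\<^sub>L 'a \<Rightarrow> 'a \<Rightarrow>\<^sub>C\<^sub>L 'a" where
  "sqrt_op A = (THE S. positive_op S \<and> S o\<^sub>C\<^sub>L S = A)"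

definition partial_isometry :: "'a::chilbert_space \<Rightarrow>\<^sub>C\<^sub>L 'b::chilbert_space \<Rightarrow> bool" where
  "partial_isometry T \<longleftrightarrow> T o\<^sub>C\<^sub>L adj T o\<^sub>C\<^sub>L T = T"

section \<open>Shmul'yan domination\<close>

abbreviation contraction :: "'a::chilbert_space \<Rightarrow>\<^sub>C\<^sub>L 'b::chilbert_space \<Rightarrow> bool" where
  "contraction A \<equiv> norm A \<le> 1"

definition defect_op :: "'a::chilbert_space \<Rightarrow>\<^sub>C\<^sub>L 'b::chilbert_space \<Rightarrow> 'a \<Rightarrow>\<^sub>C\<^sub>L 'a" where
  "defect_op A = sqrt_op (id_cblinfun - adj A o\<^sub>C\<^sub>L A)"

definition defect_space :: "'a::chilbert_space \<Rightarrow>\<^sub>C\<^sub>L 'b::chilbert_space \<Rightarrow> 'a set" where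
  "defect_space A = closure (range (cblinfun_apply (defect_op A)))"

text \<open>
  Bounded operators from a subspace \<open>S\<close> to a subspace \<open>R\<close>; the values of \<open>X\<close> outside \<open>S\<close>
  are irrelevant.
\<close>

definition bounded_clinear_between ::
  "'a::complex_normed_vector set \<Rightarrow> 'b::complex_normed_vector set \<Rightarrow> ('a \<Rightarrow> 'b) \<Rightarrow> bool" where
  "bounded_clinear_between S R X \<longleftrightarrow>
     X ` S \<subseteq> R \<and>
     (\<forall>x\<in>S. \<forall>y\<in>S. X (x + y) = X x + X y) \<and>
     (\<forall>c. \<forall>x\<in>S. X (c *\<^sub>C x) = c *\<^sub>C X x) \<and>
     (\<exists>K. \<forall>x\<in>S. norm (X x) \<le> K * norm x)"

definition shmulyan_dominates ::
  "'a::chilbert_space \<Rightarrow>\<^sub>C\<^sub>L 'b::chilbert_space \<Rightarrow> 'a \<Rightarrow>\<^sub>C\<^sub>L 'b \<Rightarrow> bool" where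
  "shmulyan_dominates A B \<longleftrightarrow> contraction A \<and> contraction B \<and>
     (\<exists>X. bounded_clinear_between (defect_space A) (defect_space (adj A)) X \<and>
        (\<forall>x. B *\<^sub>V x = A *\<^sub>V x + defect_op (adj A) *\<^sub>V X (defect_op A *\<^sub>V x)))"

definition shmulyan_equivalent ::
  "'a::chilbert_space \<Rightarrow>\<^sub>C\<^sub>L 'b::chilbert_space \<Rightarrow> 'a \<Rightarrow>\<^sub>C\<^sub>L 'b \<Rightarrow> bool" where
  "shmulyan_equivalent A B \<longleftrightarrow> shmulyan_dominates A B \<and> shmulyan_dominates B A"

definition shmulyan_part :: "'a::chilbert_space \<Rightarrow>\<^sub>C\<^sub>L 'b::chilbert_space \<Rightarrow> ('a \<Rightarrow>\<^sub>C\<^sub>L 'b) set" where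
  "shmulyan_part T = {B. contraction B \<and> shmulyan_equivalent T B}"

section \<open>The unit ball of operator-valued bounded analytic functions\<close>

text \<open>
  Analyticity is complex differentiability in the operator norm. Values of \<open>F\<close> outside
  the disc are irrelevant.
\<close>

definition analytic_on_disc :: "(complex \<Rightarrow> 'a::complex_normed_vector) \<Rightarrow> bool" where
  "analytic_on_disc F \<longleftrightarrow>
     (\<forall>z\<in>ball 0 1. \<exists>F'. (F has_derivative (\<lambda>h. h *\<^sub>C F')) (at z))"

definition Hinf1 :: "(complex \<Rightarrow> 'a::chilbert_space \<Rightarrow>\<^sub>C\<^sub>L 'b::chilbert_space) set" where
  "Hinf1 = {F. analytic_on_disc F \<and> (\<forall>z\<in>ball 0 1. norm (F z) \<le> 1)}"

section \<open>The vector-valued Hardy space\<close>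

definition hardy_series :: "(complex \<Rightarrow> 'a::chilbert_space) \<Rightarrow> (nat \<Rightarrow> 'a) \<Rightarrow> bool" where
  "hardy_series f a \<longleftrightarrow> summable (\<lambda>n. (norm (a n))\<^sup>2) \<and>
     (\<forall>z\<in>ball 0 1. (\<lambda>n. z ^ n *\<^sub>C a n) sums f z)"

lemma l2_summable_add:
  fixes a b :: "nat \<Rightarrow> 'a::real_normed_vector"
  assumes "summable (\<lambda>n. (norm (a n))\<^sup>2)" "summable (\<lambda>n. (norm (b n))\<^sup>2)"
  shows "summable (\<lambda>n. (norm (a n + b n))\<^sup>2)"
proof (rule summable_comparison_test')
  show "summable (\<lambda>n. 2 * (norm (a n))\<^sup>2 + 2 * (norm (b n))\<^sup>2)"
    using assms by (intro summable_add summable_mult)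
  fix n
  have "(norm (a n + b n))\<^sup>2 \<le> (norm (a n) + norm (b n))\<^sup>2"
    by (intro power_mono norm_triangle_ineq) simp
  also have "\<dots> \<le> 2 * (norm (a n))\<^sup>2 + 2 * (norm (b n))\<^sup>2"
    using sum_squares_bound[of "norm (a n)" "norm (b n)"] by (simp add: power2_sum)
  finally show "norm ((norm (a n + b n))\<^sup>2) \<le> 2 * (norm (a n))\<^sup>2 + 2 * (norm (b n))\<^sup>2"
    by simp
qed

lemma l2_summable_mult:
  fixes a b :: "nat \<Rightarrow> 'a::real_normed_vector"
  assumes "summable (\<lambda>n. (norm (a n))\<^sup>2)" "summable (\<lambda>n. (norm (b n))\<^sup>2)"
  shows "summable (\<lambda>n. norm (a n) * norm (b n))"
proof (rule summable_comparison_test')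
  show "summable (\<lambda>n. (norm (a n))\<^sup>2 + (norm (b n))\<^sup>2)"
    using assms by (intro summable_add)
  fix n
  have "2 * (norm (a n) * norm (b n)) \<le> (norm (a n))\<^sup>2 + (norm (b n))\<^sup>2"
    using sum_squares_bound[of "norm (a n)" "norm (b n)"] by simp
  moreover have "0 \<le> norm (a n) * norm (b n)"
    by simp
  ultimately show "norm (norm (a n) * norm (b n)) \<le> (norm (a n))\<^sup>2 + (norm (b n))\<^sup>2"
    by (simp del: mult_nonneg_nonneg)
qed

lemma l2_power_series_summable:
  fixes a :: "nat \<Rightarrow> 'a::chilbert_space"
  assumes "summable (\<lambda>n. (norm (a n))\<^sup>2)" "cmod z < 1"
  shows "summable (\<lambda>n. z ^ n *\<^sub>C a n)"
proof (rule summable_norm_cancel, rule summable_comparison_test')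
  show "summable (\<lambda>n. (cmod z ^ 2) ^ n + (norm (a n))\<^sup>2)"
    using assms by (intro summable_add summable_geometric) (simp_all add: power_less_one_iff)
  fix n
  have "2 * (cmod (z ^ n) * norm (a n)) \<le> (cmod (z ^ n))\<^sup>2 + (norm (a n))\<^sup>2"
    using sum_squares_bound[of "cmod (z ^ n)" "norm (a n)"] by simp
  moreover have "0 \<le> cmod (z ^ n) * norm (a n)"
    by simp
  ultimately have "cmod (z ^ n) * norm (a n) \<le> (cmod (z ^ n))\<^sup>2 + (norm (a n))\<^sup>2"
    by linarith
  moreover have "(cmod (z ^ n))\<^sup>2 = (cmod z ^ 2) ^ n"
    by (metis norm_power power_mult mult.commute)
  ultimately show "norm (norm (z ^ n *\<^sub>C a n)) \<le> (cmod z ^ 2) ^ n + (norm (a n))\<^sup>2"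
    by (simp add: norm_scaleC)
qed

lemma hardy_series_unique:
  assumes "hardy_series f a" "hardy_series f b"
  shows "a = b"
proof
  fix n
  define e where "e = (\<lambda>m. cinner (a m - b m) (a n - b n))"
  have sums: "(\<lambda>m. e m * z ^ m) sums 0" if "cmod z < 1" for z
  proof -
    have "(\<lambda>m. z ^ m *\<^sub>C a m - z ^ m *\<^sub>C b m) sums (f z - f z)"
      using assms that by (intro sums_diff) (auto simp: hardy_series_def)
    then have "(\<lambda>m. cinner (z ^ m *\<^sub>C a m - z ^ m *\<^sub>C b m) (a n - b n)) sums cinner 0 (a n - b n)"
      using bounded_linear.sums[OF bounded_linear_cinner_left] by fastforce
    then show ?thesis
      by (simp add: e_def cinner_scaleC_left mult.commute flip: scaleC_diff_right)
  qed
  have "e m = 0" for m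
  proof (cases "m = 0")
    case True
    then show ?thesis
      using powser_sums_zero[of e] sums[of 0] sums_unique2 by force
  next
    case False
    show ?thesis
    proof (rule ccontr)
      assume "e m \<noteq> 0"
      then obtain s where "0 < s" "\<And>z::complex. z \<in> cball 0 s - {0} \<Longrightarrow> (0::complex) \<noteq> 0"
        using powser_0_nonzero[of 1 0 e "\<lambda>_. 0" m] sums False by auto
      from this(2)[of "of_real s"] this(1) show False
        by simp
    qed
  qed
  then show "a n = b n"
    using norm_cinner_self[of "a n - b n"] by (simp add: e_def)
qed

text \<open>
  \<open>H\<^sup>2(E)\<close> consists of the functions \<open>f(z) = \<Sum>n. z\<^sup>n a\<^sub>n\<close> on the disc with
  square-summable coefficients. They are extended by 0 so that equality is equality on the disc.
\<close>

typedef (overloaded) 'a hardy =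
  "{f :: complex \<Rightarrow> 'a::chilbert_space. (\<exists>a. hardy_series f a) \<and> (\<forall>z. z \<notin> ball 0 1 \<longrightarrow> f z = 0)}"
  morphisms hardy_apply Hardy
proof
  show "(\<lambda>_. 0) \<in> {f :: complex \<Rightarrow> 'a. (\<exists>a. hardy_series f a) \<and> (\<forall>z. z \<notin> ball 0 1 \<longrightarrow> f z = 0)}"
    by (auto simp: hardy_series_def intro!: exI[of _ "\<lambda>_. 0"])
qed

setup_lifting type_definition_hardy

definition hardy_coeff :: "'a::chilbert_space hardy \<Rightarrow> nat \<Rightarrow> 'a" where
  "hardy_coeff f = (THE a. hardy_series (hardy_apply f) a)"

lemma hardy_series_coeff: "hardy_series (hardy_apply f) (hardy_coeff f)"
proof -
  have "\<exists>!a. hardy_series (hardy_apply f) a"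
    using hardy_apply[of f] by (auto intro: hardy_series_unique)
  from theI'[OF this] show ?thesis
    by (simp add: hardy_coeff_def)
qed

lemma hardy_coeffI: "hardy_series (hardy_apply f) a \<Longrightarrow> hardy_coeff f = a"
  using hardy_series_coeff hardy_series_unique by blast

lemma hardy_coeff_summable: "summable (\<lambda>n. (norm (hardy_coeff f n))\<^sup>2)"
  using hardy_series_coeff[of f] by (simp add: hardy_series_def)

lemma hardy_coeff_inject: "hardy_coeff f = hardy_coeff g \<longleftrightarrow> f = g"
proof
  assume *: "hardy_coeff f = hardy_coeff g"
  have "hardy_apply f z = hardy_apply g z" for z
  proof (cases "z \<in> ball 0 1")
    case True
    then show ?thesis
      using hardy_series_coeff[of f] hardy_series_coeff[of g] sums_unique2
      unfolding hardy_series_def * by blast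
  next
    case False
    then show ?thesis
      using hardy_apply[of f] hardy_apply[of g] by auto
  qed
  then show "f = g"
    by (simp add: hardy_apply_inject[symmetric] ext)
qed simp

lemma hardy_coeff_surj:
  fixes a :: "nat \<Rightarrow> 'a::chilbert_space"
  assumes "summable (\<lambda>n. (norm (a n))\<^sup>2)"
  obtains f where "hardy_coeff f = a"
proof -
  define f where "f = (\<lambda>z. if z \<in> ball 0 1 then \<Sum>n. z ^ n *\<^sub>C a n else 0)"
  have "hardy_series f a"
    using assms l2_power_series_summable[OF assms]
    by (auto simp: hardy_series_def f_def intro!: summable_sums)
  moreover have "hardy_apply (Hardy f) = f"
    by (rule Hardy_inverse) (use \<open>hardy_series f a\<close> in \<open>auto simp: f_def\<close>)
  ultimately have "hardy_coeff (Hardy f) = a"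
    by (intro hardy_coeffI) simp
  then show thesis
    by (rule that)
qed

lemma hardy_series_add: "hardy_series f a \<Longrightarrow> hardy_series g b \<Longrightarrow>
    hardy_series (\<lambda>z. f z + g z) (\<lambda>n. a n + b n)"
  by (auto simp: hardy_series_def scaleC_add_right l2_summable_add sums_add)

lemma hardy_series_scaleC:
  assumes "hardy_series f a"
  shows "hardy_series (\<lambda>z. c *\<^sub>C f z) (\<lambda>n. c *\<^sub>C a n)"
  unfolding hardy_series_def
proof (intro conjI ballI)
  show "summable (\<lambda>n. (norm (c *\<^sub>C a n))\<^sup>2)"
    using assms by (auto simp: hardy_series_def norm_scaleC power_mult_distrib intro: summable_mult)
  fix z :: complex assume "z \<in> ball 0 1"
  then have "(\<lambda>n. c *\<^sub>C z ^ n *\<^sub>C a n) sums (c *\<^sub>C f z)"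
    using assms by (intro bounded_linear.sums[OF bounded_linear_scaleC]) (simp add: hardy_series_def)
  then show "(\<lambda>n. z ^ n *\<^sub>C c *\<^sub>C a n) sums (c *\<^sub>C f z)"
    by (simp add: scaleC_scaleC mult.commute)
qed

lemma hardy_series_minus: "hardy_series f a \<Longrightarrow> hardy_series (\<lambda>z. - f z) (\<lambda>n. - a n)"
  using hardy_series_scaleC[of f a "- 1"] by (simp add: scaleC_minus_one)

lemma hardy_series_diff: "hardy_series f a \<Longrightarrow> hardy_series g b \<Longrightarrow>
    hardy_series (\<lambda>z. f z - g z) (\<lambda>n. a n - b n)"
  using hardy_series_add[of f a "\<lambda>z. - g z" "\<lambda>n. - b n"] hardy_series_minus by auto

lemma hardy_series_zero: "hardy_series (\<lambda>_. 0) (\<lambda>_. 0)"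
  by (simp add: hardy_series_def)

instantiation hardy :: (chilbert_space) complex_vector
begin

lift_definition zero_hardy :: "'a hardy" is "\<lambda>_. 0"
  using hardy_series_zero by auto
lift_definition plus_hardy :: "'a hardy \<Rightarrow> 'a hardy \<Rightarrow> 'a hardy" is "\<lambda>f g z. f z + g z"
  by (fastforce intro: hardy_series_add)
lift_definition uminus_hardy :: "'a hardy \<Rightarrow> 'a hardy" is "\<lambda>f z. - f z"
  by (auto dest: hardy_series_minus)
lift_definition minus_hardy :: "'a hardy \<Rightarrow> 'a hardy \<Rightarrow> 'a hardy" is "\<lambda>f g z. f z - g z"
  by (fastforce intro: hardy_series_diff)
lift_definition scaleC_hardy :: "complex \<Rightarrow> 'a hardy \<Rightarrow> 'a hardy" is "\<lambda>c f z. c *\<^sub>C f z"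
  by (auto dest: hardy_series_scaleC)
lift_definition scaleR_hardy :: "real \<Rightarrow> 'a hardy \<Rightarrow> 'a hardy" is "\<lambda>r f z. r *\<^sub>R f z"
  using hardy_series_scaleC by (auto simp: scaleR_scaleC)

instance
  by standard (transfer, simp add: algebra_simps scaleC_add_right scaleC_add_left scaleC_scaleC
      scaleR_scaleC)+

end

lemma hardy_coeff_zero: "hardy_coeff 0 = (\<lambda>_. 0)"
  by (rule hardy_coeffI) (simp add: zero_hardy.rep_eq hardy_series_zero)

lemma hardy_coeff_add: "hardy_coeff (f + g) = (\<lambda>n. hardy_coeff f n + hardy_coeff g n)"
  by (rule hardy_coeffI) (simp add: plus_hardy.rep_eq hardy_series_add hardy_series_coeff)

lemma hardy_coeff_diff: "hardy_coeff (f - g) = (\<lambda>n. hardy_coeff f n - hardy_coeff g n)"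
  by (rule hardy_coeffI) (simp add: minus_hardy.rep_eq hardy_series_diff hardy_series_coeff)

lemma hardy_coeff_scaleC: "hardy_coeff (c *\<^sub>C f) = (\<lambda>n. c *\<^sub>C hardy_coeff f n)"
  by (rule hardy_coeffI) (simp add: scaleC_hardy.rep_eq hardy_series_scaleC hardy_series_coeff)

lemma hardy_cinner_summable: "summable (\<lambda>n. cinner (hardy_coeff f n) (hardy_coeff g n))"
  by (rule summable_norm_cancel, rule summable_comparison_test'[OF
        l2_summable_mult[OF hardy_coeff_summable[of f] hardy_coeff_summable[of g]]])
     (simp add: cmod_cinner_le)

instantiation hardy :: (chilbert_space) complex_inner
begin

definition cinner_hardy :: "'a hardy \<Rightarrow> 'a hardy \<Rightarrow> complex" where
  "cinner_hardy f g = (\<Sum>n. cinner (hardy_coeff f n) (hardy_coeff g n))"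

definition inner_hardy :: "'a hardy \<Rightarrow> 'a hardy \<Rightarrow> real" where
  "inner_hardy f g = Re (cinner f g)"

definition norm_hardy :: "'a hardy \<Rightarrow> real" where
  "norm_hardy f = sqrt (inner f f)"

definition dist_hardy :: "'a hardy \<Rightarrow> 'a hardy \<Rightarrow> real" where
  "dist_hardy f g = norm (f - g)"

definition sgn_hardy :: "'a hardy \<Rightarrow> 'a hardy" where
  "sgn_hardy f = inverse (norm f) *\<^sub>R f"

definition uniformity_hardy :: "('a hardy \<times> 'a hardy) filter" where
  "uniformity_hardy = (INF e\<in>{0 <..}. principal {(x, y). dist x y < e})"

definition open_hardy :: "'a hardy set \<Rightarrow> bool" where
  "open_hardy S = (\<forall>x\<in>S. \<forall>\<^sub>F (x', y) in uniformity. x' = x \<longrightarrow> y \<in> S)"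

instance
proof
  fix f g h :: "'a hardy" and r :: real and c :: complex
  show "dist f g = norm (f - g)" "sgn f = inverse (norm f) *\<^sub>R f"
    by (simp_all add: dist_hardy_def sgn_hardy_def)
  show "(uniformity :: ('a hardy \<times> 'a hardy) filter) =
      (INF e\<in>{0 <..}. principal {(x, y). dist x y < e})"
    by (rule uniformity_hardy_def)
  show "open U \<longleftrightarrow> (\<forall>x\<in>U. \<forall>\<^sub>F (x', y) in uniformity. x' = x \<longrightarrow> y \<in> U)" for U :: "'a hardy set"
    by (rule open_hardy_def)
  show "norm f = sqrt (inner f f)"
    by (rule norm_hardy_def)
  show Re: "inner f g = Re (cinner f g)" for f g :: "'a hardy"
    by (rule inner_hardy_def)
  show comm: "cinner f g = cnj (cinner g f)" for f g :: "'a hardy"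
  proof -
    have "(\<lambda>n. cnj (cinner (hardy_coeff g n) (hardy_coeff f n))) sums cnj (cinner g f)"
      unfolding cinner_hardy_def sums_cnj by (rule summable_sums[OF hardy_cinner_summable])
    then show ?thesis
      unfolding cinner_hardy_def[of f g]
      by (simp add: sums_iff cinner_commute[of "hardy_coeff f _" "hardy_coeff g _"])
  qed
  show add: "cinner (f + g) h = cinner f h + cinner g h" for f g h :: "'a hardy"
    unfolding cinner_hardy_def hardy_coeff_add cinner_add_left
    by (rule suminf_add[symmetric]; rule hardy_cinner_summable)
  show scale: "cinner (c *\<^sub>C f) g = c * cinner f g" for c and f g :: "'a hardy"
    unfolding cinner_hardy_def hardy_coeff_scaleC cinner_scaleC_left
    by (rule suminf_mult; rule hardy_cinner_summable)
  show "inner f g = inner g f"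
    by (simp add: Re comm[of f g])
  show "inner (f + g) h = inner f h + inner g h"
    by (simp add: Re add)
  show "inner (r *\<^sub>R f) g = r * inner f g"
    by (simp add: Re scaleR_scaleC scale)
  have inner: "inner f f = (\<Sum>n. (norm (hardy_coeff f n))\<^sup>2)"
  proof -
    have "Re (cinner f f) = (\<Sum>n. Re (cinner (hardy_coeff f n) (hardy_coeff f n)))"
      unfolding cinner_hardy_def
      by (rule bounded_linear.suminf[OF bounded_linear_Re hardy_cinner_summable])
    then show ?thesis
      by (simp add: Re norm_cinner_self del: of_real_power)
  qed
  show "0 \<le> inner f f"
    unfolding inner by (intro suminf_nonneg hardy_coeff_summable) simp
  have "inner f f = 0 \<longleftrightarrow> (\<forall>n. hardy_coeff f n = 0)"
    unfolding inner by (subst suminf_eq_zero_iff) (simp_all add: hardy_coeff_summable)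
  then show "inner f f = 0 \<longleftrightarrow> f = 0"
    by (simp add: hardy_coeff_inject[symmetric] hardy_coeff_zero fun_eq_iff)
qed

end

lemma norm_hardy_sums: "(\<lambda>n. (norm (hardy_coeff f n))\<^sup>2) sums (norm f)\<^sup>2"
proof -
  have "(\<lambda>n. Re (cinner (hardy_coeff f n) (hardy_coeff f n))) sums Re (cinner f f)"
    unfolding cinner_hardy_def
    by (intro bounded_linear.sums[OF bounded_linear_Re] summable_sums hardy_cinner_summable)
  then show ?thesis
    by (simp add: norm_cinner_self del: of_real_power)
qed

lemma norm_hardy_coeff_le: "norm (hardy_coeff f n) \<le> norm f"
proof (rule power2_le_imp_le)
  have "(\<Sum>k\<in>{n}. (norm (hardy_coeff f k))\<^sup>2) \<le> (\<Sum>k. (norm (hardy_coeff f k))\<^sup>2)"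
    by (rule sum_le_suminf[OF hardy_coeff_summable]) simp_all
  then show "(norm (hardy_coeff f n))\<^sup>2 \<le> (norm f)\<^sup>2"
    using norm_hardy_sums[of f] by (simp add: sums_iff)
qed simp

instance hardy :: (chilbert_space) chilbert_space
proof
  fix F :: "nat \<Rightarrow> 'a hardy"
  assume F: "Cauchy F"
  have "Cauchy (\<lambda>k. hardy_coeff (F k) n)" for n
  proof (rule CauchyI)
    fix e :: real assume "0 < e"
    then obtain M where M: "\<forall>m\<ge>M. \<forall>k\<ge>M. norm (F m - F k) < e"
      using CauchyD[OF F] by blast
    show "\<exists>M. \<forall>m\<ge>M. \<forall>k\<ge>M. norm (hardy_coeff (F m) n - hardy_coeff (F k) n) < e"
    proof (intro exI allI impI)
      fix m k assume "m \<ge> M" "k \<ge> M"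
      then show "norm (hardy_coeff (F m) n - hardy_coeff (F k) n) < e"
        using norm_hardy_coeff_le[of "F m - F k" n] M by (force simp: hardy_coeff_diff)
    qed
  qed
  then have "\<exists>l. (\<lambda>k. hardy_coeff (F k) n) \<longlonglongrightarrow> l" for n
    using Cauchy_convergent convergent_def by blast
  then obtain a where a: "(\<lambda>k. hardy_coeff (F k) n) \<longlonglongrightarrow> a n" for n
    by metis
  have est: "\<exists>M. \<forall>k\<ge>M. \<forall>N. (\<Sum>n<N. (norm (hardy_coeff (F k) n - a n))\<^sup>2) \<le> e\<^sup>2" if "0 < e" for e
  proof -
    obtain M where M: "\<forall>m\<ge>M. \<forall>k\<ge>M. norm (F m - F k) < e"
      using CauchyD[OF F \<open>0 < e\<close>] by blast
    have "(\<Sum>n<N. (norm (hardy_coeff (F k) n - a n))\<^sup>2) \<le> e\<^sup>2" if "k \<ge> M" for k N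
    proof (rule LIMSEQ_le_const2)
      show "(\<lambda>m. \<Sum>n<N. (norm (hardy_coeff (F k) n - hardy_coeff (F m) n))\<^sup>2)
          \<longlonglongrightarrow> (\<Sum>n<N. (norm (hardy_coeff (F k) n - a n))\<^sup>2)"
        by (intro tendsto_intros a)
      show "\<exists>M. \<forall>m\<ge>M. (\<Sum>n<N. (norm (hardy_coeff (F k) n - hardy_coeff (F m) n))\<^sup>2) \<le> e\<^sup>2"
      proof (intro exI allI impI)
        fix m assume "m \<ge> M"
        have "(\<Sum>n<N. (norm (hardy_coeff (F k - F m) n))\<^sup>2) \<le> (norm (F k - F m))\<^sup>2"
          using sum_le_suminf[OF hardy_coeff_summable[of "F k - F m"], of "{..<N}"]
            norm_hardy_sums[of "F k - F m"] by (simp add: sums_iff)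
        also have "\<dots> \<le> e\<^sup>2"
          using M \<open>m \<ge> M\<close> \<open>k \<ge> M\<close> by (intro power_mono) (auto intro: less_imp_le)
        finally show "(\<Sum>n<N. (norm (hardy_coeff (F k) n - hardy_coeff (F m) n))\<^sup>2) \<le> e\<^sup>2"
          by (simp add: hardy_coeff_diff)
      qed
    qed
    then show ?thesis
      by blast
  qed
  have summ: "summable (\<lambda>n. (norm (hardy_coeff (F k) n - a n))\<^sup>2)"
    if "\<forall>N. (\<Sum>n<N. (norm (hardy_coeff (F k) n - a n))\<^sup>2) \<le> c" for k c
    using that by (intro summableI_nonneg_bounded[of _ c]) auto
  obtain M where "\<forall>N. (\<Sum>n<N. (norm (hardy_coeff (F M) n - a n))\<^sup>2) \<le> 1\<^sup>2"
    using est[of 1] by auto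
  from summ[OF this] have "summable (\<lambda>n. (norm (a n - hardy_coeff (F M) n))\<^sup>2)"
    by (simp add: norm_minus_commute)
  from l2_summable_add[OF this hardy_coeff_summable[of "F M"]]
  obtain f where f: "hardy_coeff f = a"
    using hardy_coeff_surj[of a] by auto
  have "F \<longlonglongrightarrow> f"
  proof (rule LIMSEQ_I)
    fix e :: real assume "0 < e"
    then obtain M where M: "\<forall>k\<ge>M. \<forall>N. (\<Sum>n<N. (norm (hardy_coeff (F k) n - a n))\<^sup>2) \<le> (e/2)\<^sup>2"
      using est[of "e/2"] by auto
    show "\<exists>M. \<forall>k\<ge>M. norm (F k - f) < e"
    proof (intro exI allI impI)
      fix k assume "k \<ge> M"
      have "(norm (F k - f))\<^sup>2 = (\<Sum>n. (norm (hardy_coeff (F k) n - a n))\<^sup>2)"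
        using norm_hardy_sums[of "F k - f"] by (simp add: sums_iff hardy_coeff_diff f)
      also have "\<dots> \<le> (e/2)\<^sup>2"
        using M \<open>k \<ge> M\<close> by (intro suminf_le_const summ[of k "(e/2)\<^sup>2"]) auto
      finally have "norm (F k - f) \<le> e/2"
        by (rule power2_le_imp_le) (use \<open>0 < e\<close> in simp)
      then show "norm (F k - f) < e"
        using \<open>0 < e\<close> by simp
    qed
  qed
  then show "convergent F"
    by (auto simp: convergent_def)
qed

section \<open>Toeplitz operators and Shmul'yan-ter Horst domination\<close>

text \<open>
  For bounded analytic \<open>F\<close>, multiplication by \<open>F\<close> is a bounded operator between the Hardy
  spaces, so the description denotes it; uniqueness holds because elements of the Hardy space are
  determined by their values on the disc.
\<close>

definition toeplitz ::
  "(complex \<Rightarrow> 'a::chilbert_space \<Rightarrow>\<^sub>C\<^sub>L 'b::chilbert_space) \<Rightarrow> 'a hardy \<Rightarrow>\<^sub>C\<^sub>L 'b hardy" where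
  "toeplitz F = (THE A. \<forall>g. \<forall>z\<in>ball 0 1. hardy_apply (A *\<^sub>V g) z = F z *\<^sub>V hardy_apply g z)"

definition shmulyan_terHorst_dominates ::
  "(complex \<Rightarrow> 'a::chilbert_space \<Rightarrow>\<^sub>C\<^sub>L 'b::chilbert_space) \<Rightarrow>
   (complex \<Rightarrow> 'a \<Rightarrow>\<^sub>C\<^sub>L 'b) \<Rightarrow> bool" where
  "shmulyan_terHorst_dominates G F \<longleftrightarrow>
     G \<in> Hinf1 \<and> F \<in> Hinf1 \<and> shmulyan_dominates (toeplitz G) (toeplitz F)"

end

theory Submission
  imports Defs
begin

text \<open>
  The defect operators of a partial isometry \<open>T\<close> are the orthogonal projections
  \<open>P = I - T\<^sup>*T\<close> and \<open>Q = I - TT\<^sup>*\<close>, and \<open>QT = 0 = TP\<close>. Hence \<open>T\<close> dominates \<open>B\<close> only if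
  \<open>B = T + QBP\<close>. Multiplication by the constant \<open>T\<close> is again a partial isometry, whose defect
  operators are multiplication by \<open>P\<close> and \<open>Q\<close>, so the pointwise identities \<open>G(z) = T + Q G(z) P\<close>
  say exactly that the Toeplitz operator of \<open>T\<close> dominates that of \<open>G\<close>, with \<open>X = M\<^sub>Q T\<^sub>G\<close>.
  The analytic input is that multiplication by \<open>G\<close> is a contraction between the Hardy spaces.
\<close>

section \<open>Adjoints and projections in Hilbert spaces\<close>

lemma cinner_add_right: "cinner x (y + z) = cinner x y + cinner (x::'a::complex_inner) z"
  by (subst (1 2 3) cinner_commute) (simp add: cinner_add_left)

lemma cinner_diff_right: "cinner x (y - z) = cinner x y - cinner (x::'a::complex_inner) z"
  by (subst (1 2 3) cinner_commute) (simp add: cinner_diff_left)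

lemma cinner_zero_right [simp]: "cinner (x::'a::complex_inner) 0 = 0"
  by (subst cinner_commute) simp

lemma cinner_eqI: "(\<And>z. cinner x z = cinner (y::'a::complex_inner) z) \<Longrightarrow> x = y"
proof -
  assume "\<And>z. cinner x z = cinner y z"
  then have "cinner (x - y) (x - y) = 0"
    by (simp add: cinner_diff_left)
  then show ?thesis
    by (simp add: norm_cinner_self)
qed

text \<open>The representing vector minimises the functional \<open>J\<close>, that is |x|^2 - 2
  f(x): a minimising sequence is Cauchy by the parallelogram law, and the first-order condition at
  its limit \<open>w\<close> reads f(x) = <x, w>.\<close>

lemma bounded_linear_riesz:
  fixes f :: "'a::{real_inner,complete_space} \<Rightarrow> real"
  assumes "bounded_linear f"
  obtains w where "\<And>x. f x = inner x w"
proof -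
  interpret bounded_linear f by fact
  obtain K where K: "\<And>x. norm (f x) \<le> norm x * K"
    using bounded by blast
  define J where "J = (\<lambda>x. (norm x)\<^sup>2 - 2 * f x)"
  \<comment> \<open>Since f(x) <= K |x|, \<open>J x\<close> is at least (|x| - K)^2 - K^2.\<close>
  have J_lower: "- K\<^sup>2 \<le> J x" for x
    using K[of x] zero_le_power2[of "norm x - K"]
    by (auto simp: J_def power2_eq_square algebra_simps)
  define m where "m = (INF x. J x)"
  have bdd: "bdd_below (range J)"
    using J_lower by (rule bdd_belowI2)
  have m_le: "m \<le> J x" for x
    unfolding m_def by (rule cINF_lower[OF bdd]) simp
  have "\<exists>x. J x < m + 1 / real (Suc n)" for n
  proof -
    have "(INF x. J x) < m + 1 / real (Suc n)"
      unfolding m_def[symmetric] by simp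
    then show ?thesis
      by (subst (asm) cINF_less_iff[OF _ bdd]) auto
  qed
  then obtain u where u: "\<And>n. J (u n) < m + 1 / real (Suc n)"
    by metis
  \<comment> \<open>The linear part of \<open>J\<close> cancels in this combination, which leaves
    the parallelogram law for the norm.\<close>
  have parallelogram: "(norm (x - y))\<^sup>2 = 2 * J x + 2 * J y - 4 * J ((1/2) *\<^sub>R (x + y))" for x y
    by (simp add: J_def power2_norm_eq_inner inner_add inner_diff inner_commute add scaleR field_simps)
  \<comment> \<open>The value of \<open>J\<close> at the midpoint is at least \<open>m\<close>,
    while \<open>J (u i)\<close> and \<open>J (u j)\<close> exceed \<open>m\<close> by less than
    1/(i+1) and 1/(j+1).\<close>
  have dist_u: "(norm (u i - u j))\<^sup>2 \<le> 2 / real (Suc i) + 2 / real (Suc j)" for i j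
    using u[of i] u[of j] m_le[of "(1/2) *\<^sub>R (u i + u j)"] parallelogram[of "u i" "u j"] by simp
  have "Cauchy u"
  proof (rule CauchyI)
    fix e :: real assume "0 < e"
    obtain N where "4 / e\<^sup>2 < real N"
      using reals_Archimedean2 by blast
    then have N: "4 / e\<^sup>2 < real (Suc N)"
      by simp
    show "\<exists>M. \<forall>i\<ge>M. \<forall>j\<ge>M. norm (u i - u j) < e"
    proof (intro exI allI impI)
      fix i j assume ij: "N \<le> i" "N \<le> j"
      have "(norm (u i - u j))\<^sup>2 \<le> 2 / real (Suc i) + 2 / real (Suc j)"
        by (rule dist_u)
      also have "\<dots> \<le> 2 / real (Suc N) + 2 / real (Suc N)"
        using ij by (intro add_mono divide_left_mono) auto
      also have "\<dots> = 4 / real (Suc N)"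
        by simp
      also have "\<dots> < e\<^sup>2"
        using N \<open>0 < e\<close> by (simp add: field_simps)
      finally show "norm (u i - u j) < e"
        using \<open>0 < e\<close> by (simp add: power_less_imp_less_base)
    qed
  qed
  then obtain w where w: "u \<longlonglongrightarrow> w"
    using Cauchy_convergent convergent_def by blast
  have "(\<lambda>n. J (u n)) \<longlonglongrightarrow> J w"
    unfolding J_def by (intro tendsto_intros w tendsto)
  moreover have "(\<lambda>n. m + 1 / real (Suc n)) \<longlonglongrightarrow> m + 0"
    by (intro tendsto_intros LIMSEQ_Suc[OF lim_1_over_n])
  ultimately have "J w \<le> m + 0"
    by (rule LIMSEQ_le) (use u in \<open>auto intro: less_imp_le\<close>)
  then have min: "J w \<le> J x" for x
    using m_le[of x] by simp
  have "f x = inner x w" for x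
  proof -
    define d where "d = inner x w - f x"
    have "0 \<le> t\<^sup>2 * (norm x)\<^sup>2 + 2 * t * d" for t
      using min[of "w + t *\<^sub>R x"]
      unfolding J_def d_def power2_norm_eq_inner
      by (simp add: inner_commute add scaleR algebra_simps power2_eq_square)
    \<comment> \<open>This t minimises the quadratic, whose value there is -d^2 / |x|^2.\<close>
    from this[of "- d / (norm x)\<^sup>2"] have "d\<^sup>2 \<le> 0" if "x \<noteq> 0"
      using that by (simp add: field_simps power2_eq_square)
    then have "d = 0"
      by (cases "x = 0") (simp_all add: d_def zero)
    then show ?thesis
      by (simp add: d_def)
  qed
  then show thesis
    by (rule that)
qed

text \<open>The real Riesz theorem represents Re f, and complex linearity recovers the rest through
  Im f(x) = Re f(-i x).\<close>

lemma bounded_clinear_riesz: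
  fixes f :: "'a::chilbert_space \<Rightarrow> complex"
  assumes add: "\<And>x y. f (x + y) = f x + f y" and scale: "\<And>c x. f (c *\<^sub>C x) = c * f x"
    and bound: "\<And>x. cmod (f x) \<le> K * norm x"
  obtains w where "\<And>x. f x = cinner x w"
proof -
  have "bounded_linear (\<lambda>x. Re (f x))"
  proof (rule bounded_linear_intro[of _ K])
    show "norm (Re (f x)) \<le> norm x * K" for x
      using bound[of x] abs_Re_le_cmod[of "f x"] by (simp add: mult.commute)
  qed (simp_all add: add scaleR_scaleC scale)
  then obtain w where w: "\<And>x. Re (f x) = inner x w"
    using bounded_linear_riesz by blast
  have "f x = cinner x w" for x
  proof (rule complex_eqI)
    show "Re (f x) = Re (cinner x w)"
      using w inner_eq_Re_cinner by metis
    show "Im (f x) = Im (cinner x w)"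
      using w[of "(- \<i>) *\<^sub>C x"] by (simp add: scale inner_eq_Re_cinner cinner_scaleC_left)
  qed
  then show thesis
    by (rule that)
qed

section \<open>Bounded operators and adjoints\<close>

lemma cblinfun_apply_clinear:
  shows cblinfun_add_right: "A *\<^sub>V (x + y) = A *\<^sub>V x + A *\<^sub>V y"
    and cblinfun_diff_right: "A *\<^sub>V (x - y) = A *\<^sub>V x - A *\<^sub>V y"
    and cblinfun_scaleC_right: "A *\<^sub>V (c *\<^sub>C x) = c *\<^sub>C (A *\<^sub>V x)"
    and bounded_linear_cblinfun: "bounded_linear (cblinfun_apply A)"
    and norm_cblinfun_le: "norm (A *\<^sub>V x) \<le> norm A * norm x"
proof -
  have A: "bounded_clinear (cblinfun_apply A)"
    using cblinfun_apply[of A] by simp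
  then show *: "bounded_linear (cblinfun_apply A)" and "A *\<^sub>V (c *\<^sub>C x) = c *\<^sub>C (A *\<^sub>V x)"
    by (auto simp: bounded_clinear_def)
  interpret bounded_linear "cblinfun_apply A" by fact
  show "A *\<^sub>V (x + y) = A *\<^sub>V x + A *\<^sub>V y" "A *\<^sub>V (x - y) = A *\<^sub>V x - A *\<^sub>V y"
    by (rule add diff)+
  show "norm (A *\<^sub>V x) \<le> norm A * norm x"
    unfolding norm_cblinfun.rep_eq by (rule onorm[OF *])
qed

lemmas cblinfun_simps = cblinfun_compose.rep_eq id_cblinfun.rep_eq minus_cblinfun.rep_eq
  plus_cblinfun.rep_eq

lemma norm_cblinfun_leI:
  assumes "0 \<le> K" "\<And>x. norm (A *\<^sub>V x) \<le> K * norm x"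
  shows "norm A \<le> K"
  unfolding norm_cblinfun.rep_eq by (rule onorm_bound) (rule assms)+

lemma cblinfun_of_function:
  assumes "\<And>x y. f (x + y) = f x + f y" "\<And>c x. f (c *\<^sub>C x) = c *\<^sub>C f x"
    and "\<And>x. norm (f x) \<le> K * norm x"
  obtains A where "\<And>x. A *\<^sub>V x = f x"
proof -
  have "bounded_linear f"
    using assms by (intro bounded_linear_intro[of _ K]) (simp_all add: scaleR_scaleC mult.commute)
  then have "cblinfun_apply (CBlinfun f) = f"
    using assms by (intro CBlinfun_inverse) (simp add: bounded_clinear_def)
  then show thesis
    by (intro that[of "CBlinfun f"]) simp
qed

text \<open>The inner product separates points, so at most one operator satisfies the defining
  identity. The definite description \<open>adj\<close> can therefore be evaluated by exhibiting a
  candidate.\<close>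

lemma adj_eqI:
  assumes "\<And>x y. cinner (A *\<^sub>V x) y = cinner x (B *\<^sub>V y)"
  shows "adj A = B"
  unfolding adj_def
proof (rule the_equality)
  fix C assume C: "\<forall>x y. cinner (A *\<^sub>V x) y = cinner x (C *\<^sub>V y)"
  show "C = B"
  proof (rule cblinfun_eqI, rule cinner_eqI)
    fix y z
    have "cinner z (C *\<^sub>V y) = cinner z (B *\<^sub>V y)"
      using C assms[of z y] by simp
    then show "cinner (C *\<^sub>V y) z = cinner (B *\<^sub>V y) z"
      by (simp add: cinner_commute[of _ z])
  qed
qed (use assms in blast)

text \<open>Riesz, applied to <A x, y> as a functional of x for each fixed y, gives a vector
  \<open>b y\<close>. The map \<open>b\<close> is linear because the inner product separates points,
  and it is bounded, so it is the operator that \<open>adj\<close> denotes.\<close>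

lemma cinner_adj: "cinner (A *\<^sub>V x) y = cinner x (adj A *\<^sub>V y)"
proof -
  have "\<exists>w. \<forall>x. cinner (A *\<^sub>V x) y = cinner x w" for y
  proof (rule bounded_clinear_riesz[of "\<lambda>x. cinner (A *\<^sub>V x) y" "norm A * norm y"])
    fix x
    have "cmod (cinner (A *\<^sub>V x) y) \<le> norm (A *\<^sub>V x) * norm y"
      by (rule cmod_cinner_le)
    also have "\<dots> \<le> norm A * norm x * norm y"
      by (intro mult_right_mono norm_cblinfun_le) simp
    finally show "cmod (cinner (A *\<^sub>V x) y) \<le> norm A * norm y * norm x"
      by (simp add: mult_ac)
  qed (auto simp: cblinfun_apply_clinear cinner_add_left cinner_scaleC_left)
  then obtain b where b: "\<And>x y. cinner (A *\<^sub>V x) y = cinner x (b y)"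
    by metis
  have b': "cinner (b y) x = cinner y (A *\<^sub>V x)" for x y
    using b cinner_commute by metis
  obtain B where B: "\<And>y. B *\<^sub>V y = b y"
  proof (rule cblinfun_of_function[of b "norm A"])
    show "b (x + y) = b x + b y" for x y
      by (rule cinner_eqI) (simp add: b' cinner_add_left)
    show "b (c *\<^sub>C x) = c *\<^sub>C b x" for c x
      by (rule cinner_eqI) (simp add: b' cinner_scaleC_left)
    fix y
    \<comment> \<open>Taking x = \<open>b y\<close> in the representation gives |b y|^2 = <A (b y),
      y>; one factor |b y| is then cancelled from the estimate.\<close>
    have "(norm (b y))\<^sup>2 = cmod (cinner (A *\<^sub>V b y) y)"
      by (simp add: b norm_cinner_self norm_power)
    also have "\<dots> \<le> norm (A *\<^sub>V b y) * norm y"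
      by (rule cmod_cinner_le)
    also have "\<dots> \<le> norm A * norm (b y) * norm y"
      by (intro mult_right_mono norm_cblinfun_le) simp
    finally have "norm (b y) * norm (b y) \<le> norm (b y) * (norm A * norm y)"
      by (simp add: power2_eq_square mult_ac)
    then show "norm (b y) \<le> norm A * norm y"
      by (cases "b y = 0") simp_all
  qed blast
  have "adj A = B"
    by (rule adj_eqI) (simp add: b B)
  then show ?thesis
    by (simp add: b B)
qed

lemma cinner_adj_left: "cinner (adj A *\<^sub>V x) y = cinner x (A *\<^sub>V y)"
  by (metis cinner_adj cinner_commute)

lemma adj_adj: "adj (adj A) = A"
  by (rule adj_eqI) (rule cinner_adj_left)

text \<open>Polarisation: the form <S u, u> is real, and evaluating it at u = x + y and u = x + i y
  gives two linear equations that determine the mixed terms.\<close>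

lemma positive_op_selfadjoint:
  assumes "positive_op S"
  shows "cinner (S *\<^sub>V x) y = cinner x (S *\<^sub>V y)"
proof -
  have real: "cinner (S *\<^sub>V u) u = cinner u (S *\<^sub>V u)" for u
  proof -
    have "cinner (S *\<^sub>V u) u \<in> \<real>"
      using assms by (metis positive_op_def nonneg_Reals_cases Reals_of_real)
    then show ?thesis
      by (metis cinner_commute Reals_cnj_iff)
  qed
  have 1: "cinner (S *\<^sub>V x) y + cinner (S *\<^sub>V y) x = cinner x (S *\<^sub>V y) + cinner y (S *\<^sub>V x)"
    using real[of "x + y"] real[of x] real[of y]
    by (simp add: cblinfun_apply_clinear cinner_add_left cinner_add_right add.commute)
  have "- \<i> * cinner (S *\<^sub>V x) y + \<i> * cinner (S *\<^sub>V y) x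
      = - \<i> * cinner x (S *\<^sub>V y) + \<i> * cinner y (S *\<^sub>V x)"
    using real[of "x + \<i> *\<^sub>C y"] real[of x] real[of y]
    by (simp add: cblinfun_apply_clinear cinner_add_left cinner_add_right cinner_scaleC_left
        cinner_scaleC_right algebra_simps)
  then have "\<i> * (cinner (S *\<^sub>V y) x - cinner (S *\<^sub>V x) y)
      = \<i> * (cinner y (S *\<^sub>V x) - cinner x (S *\<^sub>V y))"
    by (simp add: algebra_simps)
  then have "cinner (S *\<^sub>V y) x - cinner (S *\<^sub>V x) y = cinner y (S *\<^sub>V x) - cinner x (S *\<^sub>V y)"
    by simp
  with 1 have "2 * cinner (S *\<^sub>V x) y = 2 * cinner x (S *\<^sub>V y)"
    by algebra
  then show ?thesis
    by simp
qed

section \<open>Orthogonal projections as their own square roots\<close>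

definition is_projection :: "'a::chilbert_space \<Rightarrow>\<^sub>C\<^sub>L 'a \<Rightarrow> bool" where
  "is_projection P \<longleftrightarrow>
     P o\<^sub>C\<^sub>L P = P \<and> (\<forall>x y. cinner (P *\<^sub>V x) y = cinner x (P *\<^sub>V y))"

lemma is_projection_idem: "is_projection P \<Longrightarrow> P *\<^sub>V P *\<^sub>V x = P *\<^sub>V x"
  unfolding is_projection_def
  by (elim conjE, drule arg_cong[of _ _ "\<lambda>A. A *\<^sub>V x"]) (simp add: cblinfun_simps)

lemma is_projection_cinner_self:
  assumes "is_projection P"
  shows "cinner (P *\<^sub>V x) x = complex_of_real ((norm (P *\<^sub>V x))\<^sup>2)"
proof -
  have "cinner (P *\<^sub>V P *\<^sub>V x) x = cinner (P *\<^sub>V x) (P *\<^sub>V x)"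
    using assms unfolding is_projection_def by blast
  then show ?thesis
    by (simp add: is_projection_idem[OF assms] norm_cinner_self del: of_real_power)
qed

lemma is_projection_positive: "is_projection P \<Longrightarrow> positive_op P"
  by (simp add: positive_op_def is_projection_cinner_self del: of_real_power)

lemma is_projection_norm_le:
  assumes "is_projection P"
  shows "norm (P *\<^sub>V x) \<le> norm x"
proof -
  have "(norm (P *\<^sub>V x))\<^sup>2 = cmod (cinner (P *\<^sub>V x) x)"
    by (simp add: is_projection_cinner_self[OF assms] norm_power)
  also have "\<dots> \<le> norm (P *\<^sub>V x) * norm x"
    by (rule cmod_cinner_le)
  finally show ?thesis
    by (cases "P *\<^sub>V x = 0") (simp_all add: power2_eq_square)
qed

lemma is_projection_complement:
  assumes "is_projection P"
  shows "is_projection (id_cblinfun - P)"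
  using assms is_projection_idem[OF assms]
  by (auto simp: is_projection_def cblinfun_simps cblinfun_apply_clinear cinner_diff_left
      cinner_diff_right intro!: cblinfun_eqI)

text \<open>If S is a positive root of P, then |S x|^2 = <P x, x>, so S vanishes on the kernel of P
  and SP = S = PS. Hence y = S x - P x satisfies S y = -y, and positivity of S forces y = 0.\<close>

lemma sqrt_op_projection:
  assumes "is_projection P"
  shows "sqrt_op P = P"
  unfolding sqrt_op_def
proof (rule the_equality)
  show "positive_op P \<and> P o\<^sub>C\<^sub>L P = P"
    using assms is_projection_positive by (auto simp: is_projection_def)
  fix S assume "positive_op S \<and> S o\<^sub>C\<^sub>L S = P"
  then have pos: "positive_op S" and S2: "\<And>x. S *\<^sub>V S *\<^sub>V x = P *\<^sub>V x"
    by (blast, metis cblinfun_compose.rep_eq)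
  note P = is_projection_idem[OF assms]
  have kernel: "S *\<^sub>V x = 0" if "P *\<^sub>V x = 0" for x
  proof -
    have "cinner (S *\<^sub>V x) (S *\<^sub>V x) = cinner (P *\<^sub>V x) x"
      using positive_op_selfadjoint[OF pos] S2 by metis
    then show ?thesis
      using that by (simp add: norm_cinner_self)
  qed
  have SP: "S *\<^sub>V P *\<^sub>V x = S *\<^sub>V x" for x
    using kernel[of "P *\<^sub>V x - x"] by (simp add: cblinfun_apply_clinear P)
  \<comment> \<open>With P = SS and SP = S, the product PS is SSS = SP = S.\<close>
  have PS: "P *\<^sub>V S *\<^sub>V x = S *\<^sub>V x" for x
    by (metis S2 SP)
  show "S = P"
  proof (rule cblinfun_eqI)
    fix x
    define y where "y = S *\<^sub>V x - P *\<^sub>V x"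
    have Py: "P *\<^sub>V y = y"
      by (simp add: y_def cblinfun_apply_clinear PS P)
    have "S *\<^sub>V y = - y"
      by (simp add: y_def cblinfun_apply_clinear S2 SP)
    moreover have "Re (cinner (S *\<^sub>V y) y) \<ge> 0"
      using pos by (auto simp: positive_op_def complex_nonneg_Reals_iff)
    ultimately have "(norm y)\<^sup>2 \<le> 0"
      by (simp add: norm_cinner_self del: of_real_power)
    then show "S *\<^sub>V x = P *\<^sub>V x"
      by (simp add: y_def)
  qed
qed

section \<open>Partial isometries and their defect operators\<close>

lemma partial_isometry_apply:
  "partial_isometry T \<Longrightarrow> T *\<^sub>V adj T *\<^sub>V T *\<^sub>V x = T *\<^sub>V x"
  unfolding partial_isometry_def by (drule arg_cong[of _ _ "\<lambda>A. A *\<^sub>V x"]) (simp add: cblinfun_simps)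

lemma partial_isometry_adj:
  assumes "partial_isometry T"
  shows "partial_isometry (adj T)"
  unfolding partial_isometry_def
proof (rule cblinfun_eqI, rule cinner_eqI)
  fix x z
  show "cinner ((adj T o\<^sub>C\<^sub>L adj (adj T) o\<^sub>C\<^sub>L adj T) *\<^sub>V x) z = cinner (adj T *\<^sub>V x) z"
    by (simp only: cblinfun_simps cinner_adj adj_adj partial_isometry_apply[OF assms])
qed

text \<open>Multiplying T T* T = T by T* on the left gives idempotence; T* T is the projection onto
  the initial space of T.\<close>

lemma partial_isometry_projection:
  assumes "partial_isometry T"
  shows "is_projection (adj T o\<^sub>C\<^sub>L T)"
  unfolding is_projection_def
  by (auto simp: cblinfun_simps cinner_adj adj_adj partial_isometry_apply[OF assms]
      intro!: cblinfun_eqI)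

text \<open>With the projection P = T* T one has |T x|^2 = <P x, x> = |P x|^2, and projections do
  not increase norms.\<close>

lemma partial_isometry_contraction:
  fixes T :: "'a::chilbert_space \<Rightarrow>\<^sub>C\<^sub>L 'b::chilbert_space"
  assumes "partial_isometry T"
  shows "norm T \<le> 1"
proof (rule norm_cblinfun_leI)
  fix x :: 'a
  define P where "P = adj T o\<^sub>C\<^sub>L T"
  have P: "is_projection P"
    using partial_isometry_projection[OF assms] by (simp add: P_def)
  have "(norm (T *\<^sub>V x))\<^sup>2 = cmod (cinner (T *\<^sub>V x) (T *\<^sub>V x))"
    by (simp add: norm_cinner_self norm_power)
  also have "cinner (T *\<^sub>V x) (T *\<^sub>V x) = cinner (P *\<^sub>V x) x"
    by (simp add: P_def cblinfun_simps cinner_adj_left)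
  also have "cmod \<dots> = (norm (P *\<^sub>V x))\<^sup>2"
    by (simp add: is_projection_cinner_self[OF P] norm_power)
  also have "\<dots> \<le> (norm x)\<^sup>2"
    using is_projection_norm_le[OF P] by (simp add: power_mono)
  finally have "norm (T *\<^sub>V x) \<le> norm x"
    by (rule power2_le_imp_le) simp
  then show "norm (T *\<^sub>V x) \<le> 1 * norm x"
    by simp
qed simp

text \<open>I - T* T is the complement of the projection T* T, hence itself a projection and its own
  positive square root.\<close>

lemma partial_isometry_defect_op:
  assumes "partial_isometry T"
  shows "defect_op T = id_cblinfun - adj T o\<^sub>C\<^sub>L T"
  unfolding defect_op_def
  by (intro sqrt_op_projection is_projection_complement partial_isometry_projection assms)

lemma partial_isometry_defect_op_idem:
  assumes "partial_isometry T"
  shows "defect_op T *\<^sub>V defect_op T *\<^sub>V x = defect_op T *\<^sub>V x"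
  unfolding partial_isometry_defect_op[OF assms]
  by (intro is_projection_idem is_projection_complement partial_isometry_projection assms)

section \<open>Coefficients of weakly holomorphic functions\<close>

lemma cinner_sum_left: "cinner (\<Sum>i\<in>I. f i) (y::'a::complex_inner) = (\<Sum>i\<in>I. cinner (f i) y)"
  by (induction I rule: infinite_finite_induct) (simp_all add: cinner_add_left)

lemma cinner_sum_right: "cinner (y::'a::complex_inner) (\<Sum>i\<in>I. f i) = (\<Sum>i\<in>I. cinner y (f i))"
  by (induction I rule: infinite_finite_induct) (simp_all add: cinner_add_right)

text \<open>The sum is geometric with ratio \<open>q\<close>, and q^N = 1, so it vanishes unless q =
  1. Since n and m are below N, the powers of \<omega> are distinct and q = 1 only for n =
  m.\<close>

lemma sum_roots_of_unity_orthogonal: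
  fixes n m N :: nat
  assumes "n < N" "m < N"
  defines "\<omega> \<equiv> cis (2 * pi / real N)"
  shows "(\<Sum>k<N. (\<omega> ^ k) ^ n * cnj ((\<omega> ^ k) ^ m)) = (if n = m then of_nat N else 0)"
proof -
  define q where "q = \<omega> ^ n * cnj (\<omega> ^ m)"
  have norm_\<omega>: "cmod \<omega> = 1"
    by (simp add: \<omega>_def)
  have "\<omega> ^ N = 1"
    unfolding \<omega>_def Complex.DeMoivre using assms(1) by simp
  have mult_cnj: "\<omega> ^ m * cnj (\<omega> ^ m) = 1"
    using complex_norm_square[of "\<omega> ^ m"] by (simp add: norm_\<omega> norm_power)
  have "(\<omega> ^ k) ^ n * cnj ((\<omega> ^ k) ^ m) = q ^ k" for k
    by (simp add: q_def power_mult_distrib flip: power_mult) (simp add: mult.commute)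
  then have "(\<Sum>k<N. (\<omega> ^ k) ^ n * cnj ((\<omega> ^ k) ^ m)) = (\<Sum>k<N. q ^ k)"
    by simp
  also have "\<dots> = (if n = m then of_nat N else 0)"
  proof (cases "n = m")
    case True
    then show ?thesis
      using mult_cnj by (simp add: q_def)
  next
    case False
    have "q \<noteq> 1"
    proof
      assume "q = 1"
      have "\<omega> ^ n = q * \<omega> ^ m"
        using mult_cnj by (simp add: q_def mult_ac)
      then have "\<omega> ^ n = \<omega> ^ m"
        by (simp add: \<open>q = 1\<close>)
      moreover have "inj_on (\<lambda>k. cis (2 * pi * real k / real N)) {..<N}"
        using Complex.bij_betw_roots_unity[of N] assms by (auto simp: bij_betw_def)
      moreover have "\<omega> ^ k = cis (2 * pi * real k / real N)" for k
        by (simp add: \<omega>_def Complex.DeMoivre mult_ac)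
      ultimately show False
        using assms False by (auto simp: inj_on_def)
    qed
    moreover have "q ^ N = 1"
    proof -
      have "q ^ N = (\<omega> ^ N) ^ n * cnj ((\<omega> ^ N) ^ m)"
        by (simp add: q_def power_mult_distrib flip: power_mult) (simp add: mult.commute)
      then show ?thesis
        by (simp add: \<open>\<omega> ^ N = 1\<close>)
    qed
    ultimately show ?thesis
      using False by (simp add: geometric_sum)
  qed
  finally show ?thesis .
qed

text \<open>Expanding the squares gives a triple sum; by orthogonality, summing over k first leaves
  the diagonal n = m with the factor N.\<close>

lemma parseval_roots_of_unity:
  fixes a :: "nat \<Rightarrow> 'a::complex_inner" and N :: nat
  defines "\<omega> \<equiv> cis (2 * pi / real N)"
  shows "(\<Sum>k<N. (norm (\<Sum>n<N. (\<omega> ^ k) ^ n *\<^sub>C a n))\<^sup>2) = real N * (\<Sum>n<N. (norm (a n))\<^sup>2)"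
proof -
  have "complex_of_real (\<Sum>k<N. (norm (\<Sum>n<N. (\<omega> ^ k) ^ n *\<^sub>C a n))\<^sup>2)
      = (\<Sum>k<N. \<Sum>n<N. \<Sum>m<N. (\<omega> ^ k) ^ n * cnj ((\<omega> ^ k) ^ m) * cinner (a n) (a m))"
    unfolding of_real_sum norm_cinner_self[symmetric]
    by (simp add: cinner_sum_left cinner_sum_right cinner_scaleC_left cinner_scaleC_right
        sum_distrib_left mult_ac) (rule sum.cong[OF refl], rule sum.swap)
  also have "\<dots> = (\<Sum>n<N. \<Sum>m<N. (\<Sum>k<N. (\<omega> ^ k) ^ n * cnj ((\<omega> ^ k) ^ m)) * cinner (a n) (a m))"
    unfolding sum_distrib_right
    by (subst sum.swap, rule sum.cong[OF refl], subst sum.swap, rule refl)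
  also have "\<dots> = (\<Sum>n<N. \<Sum>m<N. if n = m then of_nat N * cinner (a n) (a m) else 0)"
    unfolding \<omega>_def by (intro sum.cong refl) (subst sum_roots_of_unity_orthogonal, auto)
  also have "\<dots> = complex_of_real (real N * (\<Sum>n<N. (norm (a n))\<^sup>2))"
    by (simp add: sum_distrib_left norm_cinner_self)
  finally show ?thesis
    by (simp only: of_real_eq_iff)
qed

text \<open>The bound does not depend on z, so the partial sums converge uniformly on the closed
  disc of radius r.\<close>

lemma power_series_tail_bound:
  fixes a :: "nat \<Rightarrow> 'a::{complex_normed_vector,banach}"
  assumes "(\<lambda>n. z ^ n *\<^sub>C a n) sums s" "summable (\<lambda>n. norm (a n) * r ^ n)" "cmod z \<le> r"
  shows "norm (s - (\<Sum>n<N. z ^ n *\<^sub>C a n)) \<le> (\<Sum>n. norm (a (n + N)) * r ^ (n + N))"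
proof -
  have "(\<lambda>n. z ^ (n + N) *\<^sub>C a (n + N)) sums (s - (\<Sum>n<N. z ^ n *\<^sub>C a n))"
    by (rule sums_split_initial_segment[OF assms(1)])
  moreover have "norm (\<Sum>n. z ^ (n + N) *\<^sub>C a (n + N)) \<le> (\<Sum>n. norm (a (n + N)) * r ^ (n + N))"
  proof (rule norm_suminf_le)
    show "summable (\<lambda>n. norm (a (n + N)) * r ^ (n + N))"
      using summable_ignore_initial_segment[OF assms(2), of N] .
    show "norm (z ^ (n + N) *\<^sub>C a (n + N)) \<le> norm (a (n + N)) * r ^ (n + N)" for n
      using assms(3)
      by (simp add: norm_scaleC norm_power mult.commute[of "norm (a (n + N))"] mult_right_mono power_mono
          del: power_add)
  qed
  ultimately show ?thesis
    by (simp add: sums_iff)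
qed

lemma suminf_tail_tendsto_0:
  fixes f :: "nat \<Rightarrow> real"
  assumes "summable f"
  shows "(\<lambda>N. \<Sum>n. f (n + N)) \<longlonglongrightarrow> 0"
proof -
  have "(\<lambda>N. suminf f - (\<Sum>n<N. f n)) \<longlonglongrightarrow> suminf f - suminf f"
    by (intro tendsto_intros summable_LIMSEQ assms)
  then show ?thesis
    by (simp add: suminf_minus_initial_segment[OF assms])
qed

text \<open>
  Averaging over the \<open>N\<close>-th roots of unity replaces integration over the circle: by Parseval it
  recovers the coefficients of the \<open>N\<close>-th partial sums exactly, and these are uniformly close to
  \<open>f\<close> and \<open>g\<close> on the circle.
\<close>

lemma power_series_l2_domination:
  fixes a :: "nat \<Rightarrow> 'a::chilbert_space" and b :: "nat \<Rightarrow> 'b::chilbert_space"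
  assumes f: "\<And>z. cmod z < 1 \<Longrightarrow> (\<lambda>n. z ^ n *\<^sub>C b n) sums f z"
    and g: "\<And>z. cmod z < 1 \<Longrightarrow> (\<lambda>n. z ^ n *\<^sub>C a n) sums g z"
    and summ_b: "\<And>r. 0 < r \<Longrightarrow> r < 1 \<Longrightarrow> summable (\<lambda>n. norm (b n) * r ^ n)"
    and summ_a: "\<And>r. 0 < r \<Longrightarrow> r < 1 \<Longrightarrow> summable (\<lambda>n. norm (a n) * r ^ n)"
    and l2: "summable (\<lambda>n. (norm (a n))\<^sup>2)"
    and le: "\<And>z. cmod z < 1 \<Longrightarrow> norm (f z) \<le> norm (g z)"
  shows "(\<Sum>n<K. (norm (b n))\<^sup>2) \<le> (\<Sum>n. (norm (a n))\<^sup>2)"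
proof -
  define A where "A = (\<Sum>n. (norm (a n))\<^sup>2)"
  have circle: "(\<Sum>n<K. (r ^ n)\<^sup>2 * (norm (b n))\<^sup>2) \<le> A" if r: "0 < r" "r < 1" for r
  proof -
    \<comment> \<open>Bounds the combined error of replacing f and g by their N-th partial sums on
      the circle of radius r.\<close>
    define \<delta> where "\<delta> = (\<lambda>N. (\<Sum>n. norm (b (n + N)) * r ^ (n + N)) + (\<Sum>n. norm (a (n + N)) * r ^ (n + N)))"
    \<comment> \<open>Bounds every partial sum of g on that circle, so that the error in the squared
      norms is independent of z.\<close>
    define M where "M = (\<Sum>n. norm (a n) * r ^ n)"
    have "\<delta> \<longlonglongrightarrow> 0 + 0"
      unfolding \<delta>_def by (intro tendsto_add suminf_tail_tendsto_0 summ_a summ_b r)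
    then have lim: "(\<lambda>N. A + \<delta> N * (2 * M + \<delta> N)) \<longlonglongrightarrow> A + 0 * (2 * M + 0)"
      by (intro tendsto_intros) simp_all
    have \<delta>_nonneg: "0 \<le> \<delta> N" for N
      unfolding \<delta>_def using r
      by (intro add_nonneg_nonneg suminf_nonneg summable_ignore_initial_segment[OF summ_a]
          summable_ignore_initial_segment[OF summ_b]) simp_all
    have bound: "(\<Sum>n<K. (r ^ n)\<^sup>2 * (norm (b n))\<^sup>2) \<le> A + \<delta> N * (2 * M + \<delta> N)"
      if N: "K \<le> N" "0 < N" for N
    proof -
      define S where "S = (\<lambda>z. \<Sum>n<N. z ^ n *\<^sub>C b n)"
      define s where "s = (\<lambda>z. \<Sum>n<N. z ^ n *\<^sub>C a n)"
      have S_le: "(norm (S z))\<^sup>2 \<le> (norm (s z))\<^sup>2 + \<delta> N * (2 * M + \<delta> N)" if z: "cmod z = r" for z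
      proof -
        have z1: "cmod z < 1"
          using z r by simp
        have "norm (S z) \<le> norm (f z) + norm (f z - S z)"
          using norm_triangle_ineq4[of "f z" "f z - S z"] by simp
        also have "\<dots> \<le> norm (g z) + norm (f z - S z)"
          using le[OF z1] by simp
        also have "\<dots> \<le> norm (s z) + norm (g z - s z) + norm (f z - S z)"
          using norm_triangle_ineq[of "s z" "g z - s z"] by simp
        also have "\<dots> \<le> norm (s z) + \<delta> N"
          using power_series_tail_bound[OF f[OF z1] summ_b[OF r], of N]
            power_series_tail_bound[OF g[OF z1] summ_a[OF r], of N] z
          by (simp add: \<delta>_def S_def s_def)
        finally have "(norm (S z))\<^sup>2 \<le> (norm (s z) + \<delta> N)\<^sup>2"
          by (rule power_mono) simp
        also have "\<dots> = (norm (s z))\<^sup>2 + \<delta> N * (2 * norm (s z) + \<delta> N)"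
          by (simp add: power2_eq_square algebra_simps)
        finally have S_s: "(norm (S z))\<^sup>2 \<le> (norm (s z))\<^sup>2 + \<delta> N * (2 * norm (s z) + \<delta> N)" .
        have "norm (s z) \<le> M"
        proof -
          have "norm (s z) \<le> (\<Sum>n<N. norm (z ^ n *\<^sub>C a n))"
            unfolding s_def by (rule norm_sum)
          also have "\<dots> = (\<Sum>n<N. norm (a n) * r ^ n)"
            by (simp add: norm_scaleC norm_power z mult.commute)
          also have "\<dots> \<le> M"
            unfolding M_def using r by (intro sum_le_suminf summ_a) auto
          finally show ?thesis .
        qed
        then have "\<delta> N * (2 * norm (s z) + \<delta> N) \<le> \<delta> N * (2 * M + \<delta> N)"
          using \<delta>_nonneg[of N] by (intro mult_left_mono) auto
        with S_s show ?thesis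
          by linarith
      qed
      \<comment> \<open>Absorbs the radius into the coefficients, so that Parseval on the unit
        circle applies to the sample points r \<omega>^k.\<close>
      have scaled: "(\<Sum>n<N. (of_real r * w) ^ n *\<^sub>C c n) = (\<Sum>n<N. w ^ n *\<^sub>C (complex_of_real (r ^ n) *\<^sub>C c n))"
        for w and c :: "nat \<Rightarrow> 'c::complex_vector"
        by (simp add: scaleC_scaleC power_mult_distrib mult.commute)
      define \<omega> where "\<omega> = cis (2 * pi / real N)"
      have norm_scaled: "(norm (complex_of_real (r ^ n) *\<^sub>C x))\<^sup>2 = (r ^ n)\<^sup>2 * (norm x)\<^sup>2"
        for n and x :: "'c::complex_normed_vector"
        using r by (simp add: norm_scaleC power_mult_distrib norm_power)
      have "real N * (\<Sum>n<N. (r ^ n)\<^sup>2 * (norm (b n))\<^sup>2) = (\<Sum>k<N. (norm (S (of_real r * \<omega> ^ k)))\<^sup>2)"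
        unfolding S_def scaled \<omega>_def parseval_roots_of_unity norm_scaled ..
      also have "\<dots> \<le> (\<Sum>k<N. (norm (s (of_real r * \<omega> ^ k)))\<^sup>2 + \<delta> N * (2 * M + \<delta> N))"
        using r by (intro sum_mono S_le) (simp add: norm_mult norm_power \<omega>_def)
      also have "\<dots> = (\<Sum>k<N. (norm (s (of_real r * \<omega> ^ k)))\<^sup>2) + real N * (\<delta> N * (2 * M + \<delta> N))"
        by (simp add: sum.distrib)
      also have "(\<Sum>k<N. (norm (s (of_real r * \<omega> ^ k)))\<^sup>2) = real N * (\<Sum>n<N. (r ^ n)\<^sup>2 * (norm (a n))\<^sup>2)"
        unfolding s_def scaled \<omega>_def parseval_roots_of_unity norm_scaled ..
      finally have "real N * (\<Sum>n<N. (r ^ n)\<^sup>2 * (norm (b n))\<^sup>2)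
          \<le> real N * ((\<Sum>n<N. (r ^ n)\<^sup>2 * (norm (a n))\<^sup>2) + \<delta> N * (2 * M + \<delta> N))"
        by (simp add: distrib_left)
      then have "(\<Sum>n<N. (r ^ n)\<^sup>2 * (norm (b n))\<^sup>2)
          \<le> (\<Sum>n<N. (r ^ n)\<^sup>2 * (norm (a n))\<^sup>2) + \<delta> N * (2 * M + \<delta> N)"
        using N by simp
      moreover have "(\<Sum>n<K. (r ^ n)\<^sup>2 * (norm (b n))\<^sup>2) \<le> (\<Sum>n<N. (r ^ n)\<^sup>2 * (norm (b n))\<^sup>2)"
        using N by (intro sum_mono2) auto
      moreover have "(\<Sum>n<N. (r ^ n)\<^sup>2 * (norm (a n))\<^sup>2) \<le> A"
      proof -
        have "(\<Sum>n<N. (r ^ n)\<^sup>2 * (norm (a n))\<^sup>2) \<le> (\<Sum>n<N. 1 * (norm (a n))\<^sup>2)"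
          using r by (intro sum_mono mult_right_mono power_le_one) auto
        also have "\<dots> \<le> A"
          unfolding A_def using l2 by (simp add: sum_le_suminf)
        finally show ?thesis .
      qed
      ultimately show ?thesis
        by linarith
    qed
    have "(\<Sum>n<K. (r ^ n)\<^sup>2 * (norm (b n))\<^sup>2) \<le> A + 0 * (2 * M + 0)"
      \<comment> \<open>Starting at \<open>Suc K\<close> ensures both K <= N and 0 < N.\<close>
      by (rule LIMSEQ_le_const[OF lim]) (use bound in \<open>auto intro!: exI[of _ "Suc K"]\<close>)
    then show ?thesis
      by simp
  qed
  \<comment> \<open>The bound \<open>A\<close> is independent of r and the left side is a finite
    sum, so r may tend to 1 from below.\<close>
  have "((\<lambda>r. \<Sum>n<K. (r ^ n)\<^sup>2 * (norm (b n))\<^sup>2) \<longlongrightarrow> (\<Sum>n<K. (1 ^ n)\<^sup>2 * (norm (b n))\<^sup>2)) (at_left 1)"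
    by (intro tendsto_intros)
  moreover have "\<forall>\<^sub>F r in at_left (1::real). (\<Sum>n<K. (r ^ n)\<^sup>2 * (norm (b n))\<^sup>2) \<le> A"
    using eventually_at_left_real[of 0 1] by (rule eventually_mono) (use circle in auto)
  ultimately have "(\<Sum>n<K. (1 ^ n)\<^sup>2 * (norm (b n))\<^sup>2) \<le> A"
    by (intro tendsto_upperbound) auto
  then show ?thesis
    by (simp add: A_def)
qed

text \<open>
  The \<open>n\<close>-th Taylor coefficient of \<open>\<langle>f(z), h\<rangle>\<close> is a bounded antilinear functional of \<open>h\<close>, so the
  Riesz theorem yields the coefficients of \<open>f\<close>.
\<close>

lemma weakly_holomorphic_power_series:
  fixes f :: "complex \<Rightarrow> 'a::chilbert_space"
  assumes hol: "\<And>h. (\<lambda>z. cinner (f z) h) holomorphic_on ball 0 1"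
    and bdd: "\<And>r. 0 < r \<Longrightarrow> r < 1 \<Longrightarrow> \<exists>M. \<forall>z. cmod z \<le> r \<longrightarrow> norm (f z) \<le> M"
  obtains b where "\<And>z. cmod z < 1 \<Longrightarrow> (\<lambda>n. z ^ n *\<^sub>C b n) sums f z"
    and "\<And>r. 0 < r \<Longrightarrow> r < 1 \<Longrightarrow> summable (\<lambda>n. norm (b n) * r ^ n)"
proof -
  define c where "c = (\<lambda>n h. (deriv ^^ n) (\<lambda>z. cinner (f z) h) 0 / fact n)"
  \<comment> \<open>Cauchy's estimate on the circle of radius r, uniform in n and h. It supplies
    both the continuity in h required by Riesz and the decay of the coefficients.\<close>
  have c_bound: "\<exists>M. \<forall>n h. cmod (c n h) \<le> M / r ^ n * norm h" if r: "0 < r" "r < 1" for r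
  proof -
    obtain M where M: "\<And>z. cmod z \<le> r \<Longrightarrow> norm (f z) \<le> M"
      using bdd[OF r] by blast
    have "cmod (c n h) \<le> M / r ^ n * norm h" for n h
    proof -
      have "cmod ((deriv ^^ n) (\<lambda>z. cinner (f z) h) 0) \<le> fact n * (M * norm h) / r ^ n"
      proof (rule Cauchy_inequality)
        show "(\<lambda>z. cinner (f z) h) holomorphic_on ball 0 r"
          using r by (intro holomorphic_on_subset[OF hol]) auto
        show "continuous_on (cball 0 r) (\<lambda>z. cinner (f z) h)"
          using r by (intro holomorphic_on_imp_continuous_on holomorphic_on_subset[OF hol]) auto
        show "cmod (cinner (f z) h) \<le> M * norm h" if "cmod (0 - z) = r" for z
          using that M[of z] by (intro order_trans[OF cmod_cinner_le] mult_right_mono) auto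
      qed (use r in simp)
      then show ?thesis
        by (simp add: c_def norm_divide field_simps)
    qed
    then show ?thesis
      by blast
  qed
  \<comment> \<open>Conjugation makes the antilinear functional linear.\<close>
  have "\<exists>w. \<forall>h. cnj (c n h) = cinner h w" for n
  proof -
    \<comment> \<open>For fixed n only boundedness in h matters, so any radius in (0,1) would
      serve.\<close>
    obtain M where M: "\<And>h. cmod (c n h) \<le> M / (1/2) ^ n * norm h"
      using c_bound[of "1/2"] by auto
    show ?thesis
    proof (rule bounded_clinear_riesz[of "\<lambda>h. cnj (c n h)"])
      show "cnj (c n (x + y)) = cnj (c n x) + cnj (c n y)" for x y
        using higher_deriv_add[OF hol hol open_ball, of 0 n x y]
        by (simp add: c_def cinner_add_right add_divide_distrib)
      show "cnj (c n (d *\<^sub>C x)) = d * cnj (c n x)" for d x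
        using higher_deriv_cmult[OF hol _ open_ball, of 0 n "cnj d" x]
        by (simp add: c_def cinner_scaleC_right)
      show "cmod (cnj (c n x)) \<le> M / (1/2) ^ n * norm x" for x
        using M[of x] by simp
    qed blast
  qed
  then obtain b where "\<And>n h. cnj (c n h) = cinner h (b n)"
    by metis
  then have b: "c n h = cinner (b n) h" for n h
    by (metis cinner_commute complex_cnj_cnj)
  have summ: "summable (\<lambda>n. norm (b n) * r ^ n)" if r: "0 < r" "r < 1" for r
  proof -
    \<comment> \<open>A radius strictly between r and 1 bounds |b n| r^n by M (r/t)^n, which yields
      a convergent geometric majorant.\<close>
    define t where "t = (r + 1) / 2"
    have t: "0 < t" "t < 1" "r < t"
      using r by (auto simp: t_def)
    obtain M where M: "\<And>n h. cmod (c n h) \<le> M / t ^ n * norm h"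
      using c_bound[OF t(1,2)] by blast
    have b_le: "norm (b n) \<le> M / t ^ n" if "b n \<noteq> 0" for n
    proof -
      have "norm (b n) * norm (b n) \<le> M / t ^ n * norm (b n)"
        using M[of n "b n"] by (simp add: b norm_cinner_self power2_eq_square norm_mult)
      then show ?thesis
        by (rule mult_right_le_imp_le) (use that in simp)
    qed
    show ?thesis
    proof (rule summable_comparison_test')
      show "summable (\<lambda>n. \<bar>M\<bar> * (r / t) ^ n)"
        using r t by (intro summable_mult summable_geometric) simp
      show "norm (norm (b n) * r ^ n) \<le> \<bar>M\<bar> * (r / t) ^ n" for n
      proof (cases "b n = 0")
        case False
        have "norm (b n) * r ^ n \<le> M / t ^ n * r ^ n"
          using r b_le[OF False] by (intro mult_right_mono) auto
        also have "\<dots> = M * (r / t) ^ n"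
          by (simp add: power_divide)
        also have "\<dots> \<le> \<bar>M\<bar> * (r / t) ^ n"
          using r t by (intro mult_right_mono) auto
        finally show ?thesis
          using r by simp
      qed (use r t in simp)
    qed
  qed
  have "(\<lambda>n. z ^ n *\<^sub>C b n) sums f z" if z: "cmod z < 1" for z
  proof -
    define r where "r = (cmod z + 1) / 2"
    have r: "0 < r" "r < 1" "cmod z \<le> r"
      using z by (auto simp: r_def add_nonneg_pos)
    have "summable (\<lambda>n. z ^ n *\<^sub>C b n)"
    proof (rule summable_norm_cancel, rule summable_comparison_test'[OF summ[OF r(1,2)]])
      show "norm (norm (z ^ n *\<^sub>C b n)) \<le> norm (b n) * r ^ n" for n
        using r by (simp add: norm_scaleC norm_power mult.commute[of "norm (b n)"] mult_right_mono power_mono)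
    qed
    then have s: "(\<lambda>n. z ^ n *\<^sub>C b n) sums (\<Sum>n. z ^ n *\<^sub>C b n)"
      by (rule summable_sums)
    \<comment> \<open>Both sides have the same pairing with each h, namely the sum of the Taylor
      series of <f(z), h>.\<close>
    have "f z = (\<Sum>n. z ^ n *\<^sub>C b n)"
    proof (rule cinner_eqI)
      fix h
      have "(\<lambda>n. c n h * (z - 0) ^ n) sums cinner (f z) h"
        unfolding c_def by (rule holomorphic_power_series[OF hol]) (use z in simp)
      moreover have "(\<lambda>n. cinner (z ^ n *\<^sub>C b n) h) sums cinner (\<Sum>n. z ^ n *\<^sub>C b n) h"
        by (rule bounded_linear.sums[OF bounded_linear_cinner_left s])
      ultimately show "cinner (f z) h = cinner (\<Sum>n. z ^ n *\<^sub>C b n) h"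
        by (simp add: b cinner_scaleC_left mult.commute sums_iff)
    qed
    with s show ?thesis
      by simp
  qed
  with summ show thesis
    by (rule that[rotated])
qed

section \<open>Toeplitz operators\<close>

lemma l2_summable_norm_power:
  assumes "summable (\<lambda>n. (norm (a n))\<^sup>2)" "0 < r" "r < 1"
  shows "summable (\<lambda>n. norm (a n) * r ^ n)"
proof -
  have "summable (\<lambda>n. (norm (r ^ n))\<^sup>2)"
    using assms summable_geometric[of "r\<^sup>2"]
    by (simp add: power_less_one_iff flip: power_mult) (simp add: mult.commute)
  moreover have "summable (\<lambda>n. (norm (norm (a n)))\<^sup>2)"
    using assms by simp
  ultimately have "summable (\<lambda>n. norm (norm (a n)) * norm (r ^ n))"
    by (intro l2_summable_mult)
  then show ?thesis
    using assms by simp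
qed

lemma hardy_sums: "cmod z < 1 \<Longrightarrow> (\<lambda>n. z ^ n *\<^sub>C hardy_coeff f n) sums hardy_apply f z"
  using hardy_series_coeff[of f] by (simp add: hardy_series_def)

lemma hardy_eqI:
  assumes "\<And>z. cmod z < 1 \<Longrightarrow> hardy_apply f z = hardy_apply g z"
  shows "f = g"
proof -
  have "hardy_apply f z = hardy_apply g z" for z
    using assms hardy_apply[of f] hardy_apply[of g] by (cases "cmod z < 1") auto
  then show ?thesis
    by (simp add: hardy_apply_inject[symmetric] ext)
qed

lemma bounded_linear_cblinfun_left: "bounded_linear (\<lambda>A. A *\<^sub>V x)"
  by (rule bounded_linear_intro[of _ "norm x"])
     (simp_all add: plus_cblinfun.rep_eq scaleR_cblinfun.rep_eq norm_cblinfun_le)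

text \<open>Evaluation at x followed by pairing with h is bounded linear in the operator, so the
  operator-norm derivative passes to an ordinary complex derivative.\<close>

lemma analytic_on_disc_holomorphic:
  assumes "analytic_on_disc F"
  shows "(\<lambda>z. cinner (F z *\<^sub>V x) h) holomorphic_on ball 0 1"
proof (rule holomorphic_onI)
  fix z :: complex assume "z \<in> ball 0 1"
  then obtain F' where "(F has_derivative (\<lambda>k. k *\<^sub>C F')) (at z)"
    using assms unfolding analytic_on_disc_def by blast
  then have "((\<lambda>z. cinner (F z *\<^sub>V x) h) has_derivative (\<lambda>k. cinner ((k *\<^sub>C F') *\<^sub>V x) h)) (at z)"
    by (intro bounded_linear.has_derivative[OF bounded_linear_compose[OF
          bounded_linear_cinner_left bounded_linear_cblinfun_left]])
  then have "((\<lambda>z. cinner (F z *\<^sub>V x) h) has_field_derivative cinner (F' *\<^sub>V x) h) (at z)"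
    by (simp add: has_field_derivative_def scaleC_cblinfun.rep_eq cinner_scaleC_left
        mult.commute[of _ "cinner _ _"])
  then show "(\<lambda>z. cinner (F z *\<^sub>V x) h) field_differentiable at z within ball 0 1"
    using field_differentiable_at_within field_differentiable_def by blast
qed

lemma hardy_tail_bound:
  assumes "0 < r" "r < 1" "cmod z \<le> r"
  shows "norm (hardy_apply g z - (\<Sum>n<N. z ^ n *\<^sub>C hardy_coeff g n))
    \<le> (\<Sum>n. norm (hardy_coeff g (n + N)) * r ^ (n + N))"
  using assms
  by (intro power_series_tail_bound hardy_sums l2_summable_norm_power hardy_coeff_summable) auto

lemma Hinf1_norm_le:
  assumes "F \<in> Hinf1" "cmod z < 1"
  shows "norm (F z *\<^sub>V x) \<le> norm x"
proof -
  have "norm (F z *\<^sub>V x) \<le> norm (F z) * norm x"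
    by (rule norm_cblinfun_le)
  also have "\<dots> \<le> 1 * norm x"
    using assms by (intro mult_right_mono) (auto simp: Hinf1_def)
  finally show ?thesis
    by simp
qed

text \<open>For the partial sums of g one gets finite sums of z^n <F(z) a_n, h>, which are
  holomorphic; they converge locally uniformly because F(z) is a contraction.\<close>

lemma Hinf1_hardy_weakly_holomorphic:
  assumes F: "F \<in> Hinf1"
  shows "(\<lambda>z. cinner (F z *\<^sub>V hardy_apply g z) h) holomorphic_on ball 0 1"
proof (rule holomorphic_uniform_sequence[OF open_ball])
  define s where "s = (\<lambda>N z. \<Sum>n<N. z ^ n *\<^sub>C hardy_coeff g n)"
  show "(\<lambda>z. cinner (F z *\<^sub>V s N z) h) holomorphic_on ball 0 1" for N
  proof -
    have "(\<lambda>z. \<Sum>n<N. z ^ n * cinner (F z *\<^sub>V hardy_coeff g n) h) holomorphic_on ball 0 1"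
      using F by (intro holomorphic_intros analytic_on_disc_holomorphic) (simp add: Hinf1_def)
    moreover have "(\<Sum>n<N. z ^ n * cinner (F z *\<^sub>V hardy_coeff g n) h) = cinner (F z *\<^sub>V s N z) h" for z
      by (simp add: s_def linear_sum[OF bounded_linear.linear[OF bounded_linear_cblinfun]]
          cinner_sum_left cblinfun_scaleC_right cinner_scaleC_left)
    ultimately show ?thesis
      by simp
  qed
  fix x :: complex assume x: "x \<in> ball 0 1"
  \<comment> \<open>Since |x| + d = r < 1, the closed disc of radius d about x lies in the disc of
    radius r, where the tail bound is uniform.\<close>
  define d where "d = (1 - cmod x) / 2"
  define r where "r = (1 + cmod x) / 2"
  have d: "0 < d" and r: "0 < r" "r < 1"
    using x by (auto simp: d_def r_def add_pos_nonneg)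
  have ball_r: "cmod z \<le> r" if "z \<in> cball x d" for z
  proof -
    have "cmod z \<le> cmod x + dist x z"
      using norm_triangle_ineq[of x "z - x"] by (simp add: dist_norm norm_minus_commute)
    then show ?thesis
      using that by (simp add: d_def r_def field_simps)
  qed
  define \<epsilon> where "\<epsilon> = (\<lambda>N. (\<Sum>n. norm (hardy_coeff g (n + N)) * r ^ (n + N)))"
  have "(\<lambda>N. \<epsilon> N * norm h) \<longlonglongrightarrow> 0 * norm h"
    unfolding \<epsilon>_def
    by (intro tendsto_mult suminf_tail_tendsto_0 l2_summable_norm_power hardy_coeff_summable r
        tendsto_const)
  have "uniform_limit (cball x d) (\<lambda>N z. cinner (F z *\<^sub>V s N z) h)
      (\<lambda>z. cinner (F z *\<^sub>V hardy_apply g z) h) sequentially"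
  proof (rule uniform_limitI)
    fix e :: real assume "0 < e"
    with \<open>(\<lambda>N. \<epsilon> N * norm h) \<longlonglongrightarrow> 0 * norm h\<close> have "\<forall>\<^sub>F N in sequentially. \<epsilon> N * norm h < e"
      using order_tendstoD(2) by fastforce
    then show "\<forall>\<^sub>F N in sequentially. \<forall>z\<in>cball x d.
        dist (cinner (F z *\<^sub>V s N z) h) (cinner (F z *\<^sub>V hardy_apply g z) h) < e"
    proof (eventually_elim, intro ballI)
      fix N z assume N: "\<epsilon> N * norm h < e" and z: "z \<in> cball x d"
      have "dist (cinner (F z *\<^sub>V s N z) h) (cinner (F z *\<^sub>V hardy_apply g z) h)
          = cmod (cinner (F z *\<^sub>V (hardy_apply g z - s N z)) h)"
        by (simp add: dist_norm norm_minus_commute cblinfun_diff_right cinner_diff_left)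
      also have "\<dots> \<le> norm (F z *\<^sub>V (hardy_apply g z - s N z)) * norm h"
        by (rule cmod_cinner_le)
      also have "\<dots> \<le> norm (hardy_apply g z - s N z) * norm h"
        using ball_r[OF z] r by (intro mult_right_mono Hinf1_norm_le F) auto
      also have "\<dots> \<le> \<epsilon> N * norm h"
        unfolding \<epsilon>_def s_def using ball_r[OF z] r by (intro mult_right_mono hardy_tail_bound) auto
      also have "\<dots> < e"
        by (rule N)
      finally show "dist (cinner (F z *\<^sub>V s N z) h) (cinner (F z *\<^sub>V hardy_apply g z) h) < e" .
    qed
  qed
  moreover have "cball x d \<subseteq> ball 0 1"
    using ball_r r by force
  ultimately show "\<exists>d>0. cball x d \<subseteq> ball 0 1 \<and>
      uniform_limit (cball x d) (\<lambda>N z. cinner (F z *\<^sub>V s N z) h)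
        (\<lambda>z. cinner (F z *\<^sub>V hardy_apply g z) h) sequentially"
    using d by blast
qed

text \<open>Pointwise |F(z) g(z)| <= |g(z)|, so \<open>power_series_l2_domination\<close> bounds the
  square sum of the Taylor coefficients of F g by |g|^2. This places F g in the Hardy space with the
  required norm.\<close>

lemma Hinf1_hardy_mult:
  assumes F: "F \<in> Hinf1"
  obtains f where "\<And>z. cmod z < 1 \<Longrightarrow> hardy_apply f z = F z *\<^sub>V hardy_apply g z" "norm f \<le> norm g"
proof -
  have bdd: "\<exists>M. \<forall>z. cmod z \<le> r \<longrightarrow> norm (F z *\<^sub>V hardy_apply g z) \<le> M" if r: "0 < r" "r < 1" for r
  proof (intro exI allI impI)
    fix z assume "cmod z \<le> r"
    then show "norm (F z *\<^sub>V hardy_apply g z) \<le> (\<Sum>n. norm (hardy_coeff g n) * r ^ n)"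
      \<comment> \<open>For N = 0 the tail bound is a bound on |g(z)| itself.\<close>
      using hardy_tail_bound[OF r, of z g 0] Hinf1_norm_le[OF F, of z "hardy_apply g z"] r by simp
  qed
  obtain b where b: "\<And>z. cmod z < 1 \<Longrightarrow> (\<lambda>n. z ^ n *\<^sub>C b n) sums (F z *\<^sub>V hardy_apply g z)"
      and summ_b: "\<And>r. 0 < r \<Longrightarrow> r < 1 \<Longrightarrow> summable (\<lambda>n. norm (b n) * r ^ n)"
    using weakly_holomorphic_power_series[OF Hinf1_hardy_weakly_holomorphic[OF F] bdd] by blast
  have le: "(\<Sum>n<K. (norm (b n))\<^sup>2) \<le> (norm g)\<^sup>2" for K
    using power_series_l2_domination[OF b hardy_sums summ_b
        l2_summable_norm_power[OF hardy_coeff_summable] hardy_coeff_summable Hinf1_norm_le[OF F], of K]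
      norm_hardy_sums[of g] by (simp add: sums_iff)
  have summ: "summable (\<lambda>n. (norm (b n))\<^sup>2)"
    by (rule summableI_nonneg_bounded[OF _ le]) simp
  then obtain f where f: "hardy_coeff f = b"
    by (rule hardy_coeff_surj)
  show thesis
  proof
    show "hardy_apply f z = F z *\<^sub>V hardy_apply g z" if "cmod z < 1" for z
      using hardy_sums[OF that, of f] b[OF that] sums_unique2 unfolding f by blast
    have "(norm f)\<^sup>2 = (\<Sum>n. (norm (b n))\<^sup>2)"
      using norm_hardy_sums[of f] by (simp add: sums_iff f)
    also have "\<dots> \<le> (norm g)\<^sup>2"
      by (rule suminf_le_const[OF summ le])
    finally show "norm f \<le> norm g"
      by (rule power2_le_imp_le) simp
  qed
qed

lemma toeplitz_eqI:
  assumes "\<And>g z. cmod z < 1 \<Longrightarrow> hardy_apply (A *\<^sub>V g) z = F z *\<^sub>V hardy_apply g z"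
  shows "toeplitz F = A"
  unfolding toeplitz_def
proof (rule the_equality)
  show "\<forall>g. \<forall>z\<in>ball 0 1. hardy_apply (A *\<^sub>V g) z = F z *\<^sub>V hardy_apply g z"
    using assms by simp
  fix B assume "\<forall>g. \<forall>z\<in>ball 0 1. hardy_apply (B *\<^sub>V g) z = F z *\<^sub>V hardy_apply g z"
  then show "B = A"
    using assms by (intro cblinfun_eqI hardy_eqI) simp
qed

text \<open>The products F g depend linearly on g, which is checked pointwise on the disc, and do
  not increase the norm; they thus form the operator that the description \<open>toeplitz\<close>
  denotes.\<close>

lemma
  assumes F: "F \<in> Hinf1"
  shows toeplitz_apply: "cmod z < 1 \<Longrightarrow> hardy_apply (toeplitz F *\<^sub>V g) z = F z *\<^sub>V hardy_apply g z"
    and toeplitz_contraction: "norm (toeplitz F) \<le> 1"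
proof -
  have "\<exists>f. (\<forall>z. cmod z < 1 \<longrightarrow> hardy_apply f z = F z *\<^sub>V hardy_apply g z) \<and> norm f \<le> norm g" for g
    using Hinf1_hardy_mult[OF F] by metis
  then obtain m where m: "\<And>g z. cmod z < 1 \<Longrightarrow> hardy_apply (m g) z = F z *\<^sub>V hardy_apply g z"
      and norm_m: "\<And>g. norm (m g) \<le> norm g"
    by metis
  obtain A where A: "\<And>g. A *\<^sub>V g = m g"
  proof (rule cblinfun_of_function[of m 1])
    show "m (x + y) = m x + m y" for x y
      by (rule hardy_eqI) (simp add: m plus_hardy.rep_eq cblinfun_add_right)
    show "m (c *\<^sub>C x) = c *\<^sub>C m x" for c x
      by (rule hardy_eqI) (simp add: m scaleC_hardy.rep_eq cblinfun_scaleC_right)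
  qed (use norm_m in auto)
  have "toeplitz F = A"
    by (rule toeplitz_eqI) (simp add: A m)
  moreover have "norm A \<le> 1"
    by (rule norm_cblinfun_leI) (simp_all add: A norm_m)
  ultimately show "norm (toeplitz F) \<le> 1"
    and "cmod z < 1 \<Longrightarrow> hardy_apply (toeplitz F *\<^sub>V g) z = F z *\<^sub>V hardy_apply g z"
    by (simp_all add: A m)
qed

section \<open>Constant symbols and their defect operators\<close>

lemma Hinf1_const: "norm A \<le> 1 \<Longrightarrow> (\<lambda>_. A) \<in> Hinf1"
  by (auto simp: Hinf1_def analytic_on_disc_def intro!: exI[of _ 0])

text \<open>A bounded operator may be applied to the power series of g term by term. The coefficient
  form is what the inner product of the Hardy space calls for.\<close>

lemma hardy_coeff_toeplitz_const:
  assumes "norm A \<le> 1"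
  shows "hardy_coeff (toeplitz (\<lambda>_. A) *\<^sub>V g) n = A *\<^sub>V hardy_coeff g n"
proof -
  have "hardy_series (hardy_apply (toeplitz (\<lambda>_. A) *\<^sub>V g)) (\<lambda>n. A *\<^sub>V hardy_coeff g n)"
    unfolding hardy_series_def
  proof (intro conjI ballI)
    show "summable (\<lambda>n. (norm (A *\<^sub>V hardy_coeff g n))\<^sup>2)"
    proof (rule summable_comparison_test'[OF hardy_coeff_summable[of g]])
      show "norm ((norm (A *\<^sub>V hardy_coeff g n))\<^sup>2) \<le> (norm (hardy_coeff g n))\<^sup>2" for n
        using Hinf1_norm_le[OF Hinf1_const[OF assms], of 0] by (simp add: power_mono)
    qed
    fix z :: complex assume "z \<in> ball 0 1"
    then show "(\<lambda>n. z ^ n *\<^sub>C (A *\<^sub>V hardy_coeff g n)) sums hardy_apply (toeplitz (\<lambda>_. A) *\<^sub>V g) z"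
      using bounded_linear.sums[OF bounded_linear_cblinfun hardy_sums[of z g], of A]
      by (simp add: toeplitz_apply[OF Hinf1_const[OF assms]] cblinfun_scaleC_right)
  qed
  then show ?thesis
    by (simp add: hardy_coeffI)
qed

text \<open>Both inner products are series over coefficients whose terms agree by the adjoint
  identity for A.\<close>

lemma adj_toeplitz_const:
  assumes "norm A \<le> 1" "norm (adj A) \<le> 1"
  shows "adj (toeplitz (\<lambda>_. A)) = toeplitz (\<lambda>_. adj A)"
  by (rule adj_eqI) (simp add: cinner_hardy_def hardy_coeff_toeplitz_const assms cinner_adj)

context
  fixes T :: "'e::chilbert_space \<Rightarrow>\<^sub>C\<^sub>L 'f::chilbert_space"
  assumes T: "partial_isometry T"
begin

text \<open>The identity T T* T = T is applied at each point of the disc.\<close>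

lemma toeplitz_const_partial_isometry:
  "adj (toeplitz (\<lambda>_. T)) = toeplitz (\<lambda>_. adj T)" "partial_isometry (toeplitz (\<lambda>_. T))"
proof -
  note T_le = partial_isometry_contraction[OF T]
    and adj_le = partial_isometry_contraction[OF partial_isometry_adj[OF T]]
  show adj: "adj (toeplitz (\<lambda>_. T)) = toeplitz (\<lambda>_. adj T)"
    by (rule adj_toeplitz_const[OF T_le adj_le])
  show "partial_isometry (toeplitz (\<lambda>_. T))"
    unfolding partial_isometry_def adj
    by (rule cblinfun_eqI, rule hardy_eqI)
      (simp add: cblinfun_simps toeplitz_apply Hinf1_const T_le adj_le partial_isometry_apply[OF T])
qed

lemma defect_op_toeplitz_const:
  assumes "cmod z < 1"
  shows "hardy_apply (defect_op (toeplitz (\<lambda>_. T)) *\<^sub>V g) z = defect_op T *\<^sub>V hardy_apply g z"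
  using assms partial_isometry_contraction[OF T] partial_isometry_contraction[OF partial_isometry_adj[OF T]]
  by (simp add: partial_isometry_defect_op toeplitz_const_partial_isometry T cblinfun_simps
      minus_hardy.rep_eq toeplitz_apply Hinf1_const)

text \<open>B itself can replace X. The defect operator P of T is idempotent and TP = 0, so the
  domination identity at P x reads B P x = Q X(P x), with Q the defect operator of T*; as Q is
  idempotent, Q B P x = Q X(P x).\<close>

lemma partial_isometry_dominates:
  assumes "shmulyan_dominates T B"
  shows "B *\<^sub>V x = T *\<^sub>V x + defect_op (adj T) *\<^sub>V B *\<^sub>V defect_op T *\<^sub>V x"
proof -
  note T' = partial_isometry_adj[OF T]
  obtain X where X: "\<And>x. B *\<^sub>V x = T *\<^sub>V x + defect_op (adj T) *\<^sub>V X (defect_op T *\<^sub>V x)"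
    using assms by (auto simp: shmulyan_dominates_def)
  have "T *\<^sub>V defect_op T *\<^sub>V x = 0"
    using partial_isometry_apply[OF T]
    by (simp add: partial_isometry_defect_op[OF T] cblinfun_simps cblinfun_diff_right)
  then show ?thesis
    using X[of x] X[of "defect_op T *\<^sub>V x"]
    by (simp add: partial_isometry_defect_op_idem T T')
qed

end

section \<open>Domination of the Toeplitz operators\<close>

theorem theorem4p1:
  fixes T :: "'e::chilbert_space \<Rightarrow>\<^sub>C\<^sub>L 'f::chilbert_space"
    and G :: "complex \<Rightarrow> 'e \<Rightarrow>\<^sub>C\<^sub>L 'f"
  assumes "separable_space (euclidean :: 'e topology)"
    and "separable_space (euclidean :: 'f topology)"
    and "partial_isometry T"
    and "G \<in> Hinf1"
    and "G ` ball 0 1 \<subseteq> shmulyan_part T"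
  shows "shmulyan_terHorst_dominates (\<lambda>_. T) G"
proof -
  note T = \<open>partial_isometry T\<close> and G = \<open>G \<in> Hinf1\<close>
  note T' = partial_isometry_adj[OF T]
  have const: "(\<lambda>_. T) \<in> Hinf1"
    by (rule Hinf1_const[OF partial_isometry_contraction[OF T]])
  define M where "M = toeplitz (\<lambda>_. T)"
  \<comment> \<open>The outer factor places the values of \<open>X\<close> in the defect space of
    \<open>adj M\<close>; being idempotent, it leaves the product in the domination identity
    unchanged.\<close>
  define X where "X = (\<lambda>g. defect_op (adj M) *\<^sub>V toeplitz G *\<^sub>V g)"
  have adj_M: "adj M = toeplitz (\<lambda>_. adj T)"
    unfolding M_def by (rule toeplitz_const_partial_isometry[OF T])
  have "bounded_clinear_between (defect_space M) (defect_space (adj M)) X"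
    unfolding bounded_clinear_between_def
  proof (intro conjI ballI allI)
    show "X ` defect_space M \<subseteq> defect_space (adj M)"
    proof (rule image_subsetI)
      fix g
      have "X g \<in> range (cblinfun_apply (defect_op (adj M)))"
        unfolding X_def by (rule rangeI)
      then show "X g \<in> defect_space (adj M)"
        unfolding defect_space_def by (rule subsetD[OF closure_subset])
    qed
    have "norm (X g) \<le> norm (defect_op (adj M) o\<^sub>C\<^sub>L toeplitz G) * norm g" for g
      using norm_cblinfun_le[of "defect_op (adj M) o\<^sub>C\<^sub>L toeplitz G" g]
      by (simp add: X_def cblinfun_compose.rep_eq)
    then show "\<exists>K. \<forall>g\<in>defect_space M. norm (X g) \<le> K * norm g"
      by blast
  qed (simp_all add: X_def cblinfun_add_right cblinfun_scaleC_right)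
  moreover have "toeplitz G *\<^sub>V g = M *\<^sub>V g + defect_op (adj M) *\<^sub>V X (defect_op M *\<^sub>V g)" for g
  proof (rule hardy_eqI)
    fix z assume z: "cmod z < 1"
    then have "G z \<in> shmulyan_part T"
      using assms(5) by auto
    then have dom: "shmulyan_dominates T (G z)"
      by (simp add: shmulyan_part_def shmulyan_equivalent_def)
    \<comment> \<open>At z all operators act pointwise, and the repeated defect factor of T*
      collapses to one.\<close>
    have "hardy_apply (M *\<^sub>V g + defect_op (adj M) *\<^sub>V X (defect_op M *\<^sub>V g)) z
        = T *\<^sub>V hardy_apply g z
          + defect_op (adj T) *\<^sub>V G z *\<^sub>V hardy_apply (defect_op M *\<^sub>V g) z"
      by (simp add: X_def adj_M z toeplitz_apply G plus_hardy.rep_eq defect_op_toeplitz_const[OF T']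
          partial_isometry_defect_op_idem[OF T'])
        (simp add: M_def z toeplitz_apply const)
    also have "hardy_apply (defect_op M *\<^sub>V g) z = defect_op T *\<^sub>V hardy_apply g z"
      unfolding M_def by (rule defect_op_toeplitz_const[OF T z])
    also have "T *\<^sub>V hardy_apply g z + defect_op (adj T) *\<^sub>V G z *\<^sub>V defect_op T *\<^sub>V hardy_apply g z
        = G z *\<^sub>V hardy_apply g z"
      by (rule partial_isometry_dominates[OF T dom, symmetric])
    also have "\<dots> = hardy_apply (toeplitz G *\<^sub>V g) z"
      by (rule toeplitz_apply[OF G z, symmetric])
    finally show "hardy_apply (toeplitz G *\<^sub>V g) z
        = hardy_apply (M *\<^sub>V g + defect_op (adj M) *\<^sub>V X (defect_op M *\<^sub>V g)) z" ..
  qed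
  ultimately have "shmulyan_dominates M (toeplitz G)"
    using toeplitz_contraction[OF const] toeplitz_contraction[OF G]
    by (auto simp: shmulyan_dominates_def M_def)
  then show ?thesis
    using const G by (simp add: shmulyan_terHorst_dominates_def M_def)
qed

end
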